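(* Let $p,q,n$ be positive integers with $n\ge p$ and $n\ge q$, let $a\in M_{p\times q}(\mathbb N)$ be such that $\sum_{i,j}a_{ij}$ is even, and put $k=\frac12\sum_{i,j}a_{ij}$. Then $$\int_{O_n}\prod_{i=1}^p\prod_{j=1}^q u_{ij}^{a_{ij}}\,du=\sum_{\pi,\sigma}\delta_\pi(a_l)\,\delta_\sigma(a_r)\,W_{kn}(\pi,\sigma),$$ where the sum is over all pairs $(\pi,\sigma)$ of pairings of $\{1,\ldots,2k\}$.
   Context: $\mathbb N=\{0,1,2,\ldots\}$. $O_n$ is the group of real orthogonal $n\times n$ matrices $u=(u_{ij})$, and $du$ is its normalized (probability) Haar measure. A pairing of $\{1,\ldots,2k\}$ is a partition of this set into $k$ blocks of size $2$. For a multi-index $i=(i_1,\ldots,i_{2k})$ of positive integers and a pairing $\pi$, $\delta_\pi(i)=1$ if $i_s=i_t$ for every block $\{s,t\}\in\pi$, and $\delta_\pi(i)=0$ otherwise. $G_{kn}$ is the real symmetric matrix indexed by pairings of $\{1,\ldots,2k\}$ with entries $G_{kn}(\pi,\sigma)=n^{\mathrm{loops}(\pi,\sigma)}$, where $\mathrm{loops}(\pi,\sigma)$ is the number of loops obtained by superposing $\pi$ and $\sigma$, i.e. the number of connected components of the multigraph on $\{1,\ldots,2k\}$ whose edges are the blocks of $\pi$ together with the blocks of $\sigma$. The Weingarten matrix $W_{kn}$ is the (Moore–Penrose) pseudo-inverse of $G_{kn}$; in particular $W_{kn}G_{kn}W_{kn}=W_{kn}$ and $G_{kn}W_{kn}G_{kn}=G_{kn}$,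 and $W_{kn}=G_{kn}^{-1}$ if $G_{kn}$ is invertible. The multi-indices $a_l,a_r$ of length $2k$ are obtained from $a$ as follows: reading the entries of $a$ row by row, from left to right in each row, replace the entry $a_{ij}$ by $a_{ij}$ consecutive copies of $i$ (to get $a_l$), respectively by $a_{ij}$ consecutive copies of $j$ (to get $a_r$). Thus $a_l=(\underbrace{1\ldots1}_{a_{11}}\underbrace{1\ldots1}_{a_{12}}\ldots\underbrace{p\ldots p}_{a_{pq}})$ and $a_r=(\underbrace{1\ldots1}_{a_{11}}\underbrace{2\ldots2}_{a_{12}}\ldots\underbrace{q\ldots q}_{a_{pq}})$. *)

theory Defs
  imports "HOL-Probability.Probability" "HOL-Library.Disjoint_Sets"
begin

(* Normalized Haar measure on the compact group O_n: the left-invariant Borel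
   probability measure. Regularity is automatic on a compact metric space. *)
definition normalized_haar_orthogonal :: "(real^'n^'n) measure \<Rightarrow> bool" where
  "normalized_haar_orthogonal \<mu> \<longleftrightarrow>
     sets \<mu> = sets (restrict_space borel {u. orthogonal_matrix u}) \<and>
     prob_space \<mu> \<and>
     (\<forall>g. orthogonal_matrix g \<longrightarrow>
       (\<forall>A \<in> sets \<mu>. emeasure \<mu> ((\<lambda>u. g ** u) ` A) = emeasure \<mu> A))"

definition pairings :: "nat \<Rightarrow> nat set set set" where
  "pairings k = {P. partition_on {1..2*k} P \<and> (\<forall>B\<in>P. card B = 2)}"

(* A multi-index (i_1, ..., i_2k) is a list; its entry i_s is xs ! (s - 1). *)
definition pairing_delta :: "nat set set \<Rightarrow> nat list \<Rightarrow> real" where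
  "pairing_delta P xs =
     (if \<forall>s t. {s, t} \<in> P \<longrightarrow> xs ! (s - 1) = xs ! (t - 1) then 1 else 0)"

(* The classes of the reflexive transitive closure of the (symmetric) adjacency
   relation are the connected components of the superposition of P and Q. *)
definition loops :: "nat \<Rightarrow> nat set set \<Rightarrow> nat set set \<Rightarrow> nat" where
  "loops k P Q = card ({1..2*k} // {(s, t). {s, t} \<in> P \<union> Q}\<^sup>*)"

definition gram :: "nat \<Rightarrow> nat \<Rightarrow> nat set set \<Rightarrow> nat set set \<Rightarrow> real" where
  "gram k n P Q = real n ^ loops k P Q"

(* Square real matrices indexed by a finite set S are functions of two arguments,
   of which only the values on S are relevant. *)
definition mult_on :: "'a set \<Rightarrow> ('a \<Rightarrow> 'a \<Rightarrow> real) \<Rightarrow> ('a \<Rightarrow> 'a \<Rightarrow> real) \<Rightarrow> 'a \<Rightarrow> 'a \<Rightarrow> real" where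
  "mult_on S A B = (\<lambda>x y. \<Sum>z\<in>S. A x z * B z y)"

definition moore_penrose_on :: "'a set \<Rightarrow> ('a \<Rightarrow> 'a \<Rightarrow> real) \<Rightarrow> ('a \<Rightarrow> 'a \<Rightarrow> real) \<Rightarrow> bool" where
  "moore_penrose_on S A B \<longleftrightarrow>
     (\<forall>x\<in>S. \<forall>y\<in>S.
        mult_on S (mult_on S A B) A x y = A x y \<and>
        mult_on S (mult_on S B A) B x y = B x y \<and>
        mult_on S A B x y = mult_on S A B y x \<and>
        mult_on S B A x y = mult_on S B A y x)"

(* Extending by zero outside S makes the pseudo-inverse unique as a function. *)
definition pseudo_inverse_on :: "'a set \<Rightarrow> ('a \<Rightarrow> 'a \<Rightarrow> real) \<Rightarrow> 'a \<Rightarrow> 'a \<Rightarrow> real" where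
  "pseudo_inverse_on S A =
     (THE B. moore_penrose_on S A B \<and> (\<forall>x y. x \<notin> S \<or> y \<notin> S \<longrightarrow> B x y = 0))"

definition weingarten :: "nat \<Rightarrow> nat \<Rightarrow> nat set set \<Rightarrow> nat set set \<Rightarrow> real" where
  "weingarten k n = pseudo_inverse_on (pairings k) (gram k n)"

definition left_index :: "nat \<Rightarrow> nat \<Rightarrow> (nat \<Rightarrow> nat \<Rightarrow> nat) \<Rightarrow> nat list" where
  "left_index p q a =
     concat (map (\<lambda>i. concat (map (\<lambda>j. replicate (a i j) i) [1..<Suc q])) [1..<Suc p])"

definition right_index :: "nat \<Rightarrow> nat \<Rightarrow> (nat \<Rightarrow> nat \<Rightarrow> nat) \<Rightarrow> nat list" where
  "right_index p q a =
     concat (map (\<lambda>i. concat (map (\<lambda>j. replicate (a i j) j) [1..<Suc q])) [1..<Suc p])"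

end

(* For fixed column indices j, both sides are tensors in the row indices i that are
   invariant under O_n, and for every pairing they have the same scalar product with the
   tensor delta_pi: for the integral because of orthogonality of the columns, for the right
   hand side because G W G = G and G is the Gram matrix of the delta_pi. So it suffices that
   an invariant tensor T orthogonal to all delta_pi vanishes (Brauer's theorem in dual form).
   All contractions of T vanish by induction on the order m of T. Invariance under so_n says
   E_ab T = E_ba T for the matrix units, and summing <E_ab T, E_ba T> over a, b gives m |T|^2
   plus the norms of the contractions, that is, m |T|^2. Invariance under sign changes of the
   coordinates makes all multiplicities even in the support of T, hence
   the sum of the |E_aa T|^2 alone is at least 2 m |T|^2, and T = 0. *)
theory Submission
  imports Defs
begin

section \<open>Pseudo-inverses of symmetric matrices\<close>

text \<open>For n < k the Gram matrix G can be singular, and then G W is only a projection. The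
  scalar products still agree: G W and the identity act alike on the values of the delta_sigma at j,
  because their difference is a combination of the delta_sigma that is orthogonal to all of them,
  hence zero. Since W is given by a definite description, existence and uniqueness of the
  pseudo-inverse have to be established before \<open>G W G = G\<close> is available.

  The sign changes are what separates O_n from SO_n. The determinant tensor of order n is nonzero,
  invariant under rotations and orthogonal to every delta_pi. Each coordinate occurs exactly once in
  its support, so its diagonal terms |E_aa T|^2 add up to n |T|^2, in accordance with the norm
  identity. Even multiplicities double this contribution, and the factor 2 is the whole
  contradiction.\<close>

lemma mult_on_assoc:
  "mult_on S (mult_on S A B) C = mult_on S A (mult_on S B C)"
proof (intro ext)
  fix x y
  have "mult_on S (mult_on S A B) C x y = (\<Sum>z\<in>S. \<Sum>w\<in>S. A x w * B w z * C z y)"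
    by (simp add: mult_on_def sum_distrib_right)
  also have "\<dots> = (\<Sum>w\<in>S. \<Sum>z\<in>S. A x w * B w z * C z y)"
    by (rule sum.swap)
  also have "\<dots> = mult_on S A (mult_on S B C) x y"
    by (simp add: mult_on_def sum_distrib_left mult.assoc)
  finally show "mult_on S (mult_on S A B) C x y = mult_on S A (mult_on S B C) x y" .
qed

definition entry_transpose :: "('a \<Rightarrow> 'a \<Rightarrow> real) \<Rightarrow> 'a \<Rightarrow> 'a \<Rightarrow> real" where
  "entry_transpose A = (\<lambda>x y. A y x)"

lemma entry_transpose_entry_transpose [simp]: "entry_transpose (entry_transpose A) = A"
  by (simp add: entry_transpose_def)

lemma entry_transpose_mult_on: "entry_transpose (mult_on S A B) = mult_on S (entry_transpose B) (entry_transpose A)"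
  by (simp add: entry_transpose_def mult_on_def mult.commute)

definition supported :: "'a set \<Rightarrow> ('a \<Rightarrow> 'a \<Rightarrow> real) \<Rightarrow> bool" where
  "supported S A \<longleftrightarrow> (\<forall>x y. x \<notin> S \<or> y \<notin> S \<longrightarrow> A x y = 0)"

lemma supported_mult_on: "supported S A \<Longrightarrow> supported S B \<Longrightarrow> supported S (mult_on S A B)"
  by (auto simp: supported_def mult_on_def)

lemma supported_entry_transpose: "supported S A \<Longrightarrow> supported S (entry_transpose A)"
  by (auto simp: supported_def entry_transpose_def)

lemma supported_eqI:
  assumes "supported S A" "supported S B" "\<And>x y. x \<in> S \<Longrightarrow> y \<in> S \<Longrightarrow> A x y = B x y"
  shows "A = B"
proof (intro ext)
  fix x y show "A x y = B x y"
    using assms unfolding supported_def by (cases "x \<in> S \<and> y \<in> S") auto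
qed

text \<open>For matrices extended by zero the entrywise conditions on \<open>S\<close> become
  equations between functions, which can be rewritten by associativity and transposition.\<close>

lemma moore_penrose_on_supported_iff:
  assumes "supported S A" "supported S B"
  shows "moore_penrose_on S A B \<longleftrightarrow>
    mult_on S (mult_on S A B) A = A \<and> mult_on S (mult_on S B A) B = B \<and>
    entry_transpose (mult_on S A B) = mult_on S A B \<and> entry_transpose (mult_on S B A) = mult_on S B A"
proof
  assume mp: "moore_penrose_on S A B"
  note supp = assms supported_mult_on supported_entry_transpose
  show "mult_on S (mult_on S A B) A = A \<and> mult_on S (mult_on S B A) B = B \<and>
    entry_transpose (mult_on S A B) = mult_on S A B \<and> entry_transpose (mult_on S B A) = mult_on S B A"
    using mp unfolding moore_penrose_on_def
    by (intro conjI; intro supported_eqI[of S] supp) (auto simp: entry_transpose_def)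
next
  assume *: "mult_on S (mult_on S A B) A = A \<and> mult_on S (mult_on S B A) B = B \<and>
    entry_transpose (mult_on S A B) = mult_on S A B \<and> entry_transpose (mult_on S B A) = mult_on S B A"
  show "moore_penrose_on S A B"
    unfolding moore_penrose_on_def using *
    by (metis entry_transpose_def)
qed

text \<open>Penrose's argument: AX = (AYA)X = (AY)(AX), and transposing this product of symmetric
  matrices gives AX = (AX)(AY) = (AXA)Y = AY. Likewise XA = YA, so X = XAX = XAY = YAY = Y.\<close>

lemma moore_penrose_on_unique:
  assumes A: "supported S A" and X: "supported S X" "moore_penrose_on S A X"
    and Y: "supported S Y" "moore_penrose_on S A Y"
  shows "X = Y"
proof -
  let ?m = "mult_on S"
  have x: "?m (?m A X) A = A" "?m (?m X A) X = X" "entry_transpose (?m A X) = ?m A X" "entry_transpose (?m X A) = ?m X A"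
    using X moore_penrose_on_supported_iff[OF A] by auto
  have y: "?m (?m A Y) A = A" "?m (?m Y A) Y = Y" "entry_transpose (?m A Y) = ?m A Y" "entry_transpose (?m Y A) = ?m Y A"
    using Y moore_penrose_on_supported_iff[OF A] by auto
  have "?m A X = ?m (?m A Y) (?m A X)" by (metis mult_on_assoc y(1))
  then have "?m A X = ?m (?m A X) (?m A Y)" by (metis entry_transpose_mult_on x(3) y(3))
  also have "\<dots> = ?m A Y" by (metis mult_on_assoc x(1))
  finally have AXY: "?m A X = ?m A Y" .
  have "?m X A = ?m (?m X A) (?m Y A)" by (metis mult_on_assoc y(1))
  then have "?m X A = ?m (?m Y A) (?m X A)" by (metis entry_transpose_mult_on x(4) y(4))
  also have "\<dots> = ?m Y A" by (metis mult_on_assoc x(1))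
  finally have XAY: "?m X A = ?m Y A" .
  have "X = ?m X (?m A X)" by (metis mult_on_assoc x(2))
  also have "\<dots> = ?m (?m X A) Y" by (simp add: AXY mult_on_assoc)
  also have "\<dots> = Y" by (simp add: XAY y(2))
  finally show ?thesis .
qed

text \<open>One Gram-Schmidt step per vector: the new vector \<open>v r\<close> is replaced by its
  component orthogonal to the span so far. The family may be linearly dependent, as the rows of a
  singular Gram matrix are.\<close>

lemma orthogonal_projection_exists:
  fixes v :: "'b \<Rightarrow> 'a \<Rightarrow> real"
  assumes "finite F" "finite S"
  shows "\<exists>c. \<forall>t\<in>F. (\<Sum>x\<in>S. (y x - (\<Sum>s\<in>F. c s * v s x)) * v t x) = 0"
  using assms(1)
proof (induction F arbitrary: y rule: finite_induct)
  case empty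
  then show ?case by simp
next
  case (insert r F)
  obtain c where c: "\<And>t. t \<in> F \<Longrightarrow> (\<Sum>x\<in>S. (y x - (\<Sum>s\<in>F. c s * v s x)) * v t x) = 0"
    using insert.IH by blast
  obtain d where d: "\<And>t. t \<in> F \<Longrightarrow> (\<Sum>x\<in>S. (v r x - (\<Sum>s\<in>F. d s * v s x)) * v t x) = 0"
    using insert.IH by blast
  define z where "z x = y x - (\<Sum>s\<in>F. c s * v s x)" for x
  define w where "w x = v r x - (\<Sum>s\<in>F. d s * v s x)" for x
  have z0: "(\<Sum>x\<in>S. z x * v t x) = 0" if "t \<in> F" for t using c[OF that] by (simp add: z_def)
  have w0: "(\<Sum>x\<in>S. w x * v t x) = 0" if "t \<in> F" for t using d[OF that] by (simp add: w_def)
  \<comment> \<open>Against anything orthogonal to the old vectors, \<open>v r\<close> and its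
    orthogonal component \<open>w\<close> have the same scalar product.\<close>
  have r0: "(\<Sum>x\<in>S. f x * v r x) = (\<Sum>x\<in>S. f x * w x)"
    if f: "\<And>t. t \<in> F \<Longrightarrow> (\<Sum>x\<in>S. f x * v t x) = 0" for f
  proof -
    have "(\<Sum>x\<in>S. f x * (\<Sum>s\<in>F. d s * v s x)) = (\<Sum>x\<in>S. \<Sum>s\<in>F. d s * (f x * v s x))"
      by (simp add: sum_distrib_left mult.left_commute)
    also have "\<dots> = (\<Sum>s\<in>F. d s * (\<Sum>x\<in>S. f x * v s x))"
      by (subst sum.swap) (simp add: sum_distrib_left)
    also have "\<dots> = 0" using f by simp
    finally show ?thesis by (simp add: w_def algebra_simps sum_subtractf)
  qed
  define ww where "ww = (\<Sum>x\<in>S. w x * w x)"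
  \<comment> \<open>If \<open>w\<close> vanishes, division by zero makes this coefficient 0, and the
    equation below still holds.\<close>
  define \<alpha> where "\<alpha> = (\<Sum>x\<in>S. z x * w x) / ww"
  have \<alpha>: "(\<Sum>x\<in>S. z x * w x) = \<alpha> * ww"
  proof (cases "ww = 0")
    case True
    then have "\<forall>x\<in>S. w x * w x = 0"
      unfolding ww_def using assms(2) by (subst (asm) sum_nonneg_eq_0_iff) auto
    then show ?thesis using True by simp
  qed (simp add: \<alpha>_def)
  \<comment> \<open>The projection grows by \<alpha> times \<open>w\<close>, which is
    \<open>v r\<close> minus the combination with coefficients \<open>d\<close>.\<close>
  define c' where "c' s = (if s = r then \<alpha> else c s - \<alpha> * d s)" for s
  have "y x - (\<Sum>s\<in>insert r F. c' s * v s x) = z x - \<alpha> * w x" for x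
  proof -
    have "(\<Sum>s\<in>F. c' s * v s x) = (\<Sum>s\<in>F. c s * v s x - \<alpha> * (d s * v s x))"
      using insert.hyps by (intro sum.cong) (auto simp: c'_def algebra_simps)
    then show ?thesis using insert.hyps
      by (simp add: z_def w_def c'_def sum_subtractf sum_distrib_left algebra_simps)
  qed
  moreover have "(\<Sum>x\<in>S. (z x - \<alpha> * w x) * v t x) = 0" if "t \<in> F" for t
    using z0[OF that] w0[OF that]
    by (simp add: left_diff_distrib sum_subtractf mult.assoc flip: sum_distrib_left)
  moreover have "(\<Sum>x\<in>S. (z x - \<alpha> * w x) * v r x) = 0"
    using \<alpha> r0[of "\<lambda>x. z x - \<alpha> * w x", OF calculation(2)]
    by (simp add: left_diff_distrib sum_subtractf mult.assoc ww_def flip: sum_distrib_left)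
  ultimately show ?case by (intro exI[of _ c']) auto
qed

text \<open>For symmetric $G$ the normal equations give $H$ with $G = H G^2$; then $P = HG$ is symmetric with
  $PG = GP = G$, and $W = H G H^{T}$ is the pseudo-inverse.\<close>

lemma moore_penrose_exists_symmetric:
  assumes "finite S" and G: "supported S G" and sym: "entry_transpose G = G"
  shows "\<exists>W. supported S W \<and> moore_penrose_on S G W"
proof -
  let ?m = "mult_on S"
  \<comment> \<open>The unit vector at \<open>z\<close> is projected onto the span of the rows of
    \<open>G\<close>; the coefficients become row \<open>z\<close> of \<open>H\<close>, and the
    normal equations read G = H G G.\<close>
  have "\<exists>c. \<forall>t\<in>S. (\<Sum>x\<in>S. (of_bool (x = z) - (\<Sum>s\<in>S. c s * G s x)) * G t x) = 0" for z
    using orthogonal_projection_exists[OF assms(1) assms(1), of "\<lambda>x. of_bool (x = z)" G] by simp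
  then obtain c where c: "\<And>z t. t \<in> S \<Longrightarrow>
      (\<Sum>x\<in>S. (of_bool (x = z) - (\<Sum>s\<in>S. c z s * G s x)) * G t x) = 0"
    by metis
  define H where "H x y = (if x \<in> S \<and> y \<in> S then c x y else 0)" for x y
  have H: "supported S H" by (simp add: supported_def H_def)
  have symG: "G x y = G y x" for x y using sym by (metis entry_transpose_def)
  have 1: "?m (?m H G) G = G"
  proof (rule supported_eqI[of S])
    fix z t assume zt: "z \<in> S" "t \<in> S"
    have "(\<Sum>x\<in>S. of_bool (x = z) * G t x) = (\<Sum>x\<in>S. (\<Sum>s\<in>S. c z s * G s x) * G t x)"
      using c[OF zt(2), of z] by (simp add: left_diff_distrib sum_subtractf)
    moreover have "(\<Sum>x\<in>S. of_bool (x = z) * G t x) = G z t"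
      using zt assms(1) symG[of z t] by (simp add: Int_insert_right)
    moreover have "(\<Sum>x\<in>S. (\<Sum>s\<in>S. c z s * G s x) * G t x) = ?m (?m H G) G z t"
      unfolding mult_on_def using zt symG by (intro sum.cong) (auto simp: H_def)
    ultimately show "?m (?m H G) G z t = G z t" by simp
  qed (intro supported_mult_on G H)+
  define K where "K = entry_transpose H"
  have 2: "?m G (?m G K) = G" 
    using arg_cong[OF 1, of entry_transpose] by (simp add: entry_transpose_mult_on sym K_def)
  \<comment> \<open>H G = H (G G K) = (H G G) K = G K, so the projection H G equals its own
    transpose.\<close>
  have HG: "?m H G = ?m G K"
    by (metis 1 2 mult_on_assoc)
  define W where "W = ?m (?m H G) K"
  have W: "supported S W" unfolding W_def K_def by (intro supported_mult_on supported_entry_transpose G H)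
  have tP: "entry_transpose (?m H G) = ?m H G" by (metis HG K_def sym entry_transpose_mult_on)
  have WG: "?m W G = ?m H G" unfolding W_def by (metis HG 1 mult_on_assoc)
  have tW: "entry_transpose W = W" by (simp add: W_def entry_transpose_mult_on sym mult_on_assoc K_def)
  have GW: "?m G W = ?m H G" by (metis WG tP tW sym entry_transpose_mult_on)
  have "?m (?m G W) G = G" by (simp add: GW 1)
  moreover have "?m (?m W G) W = W"
    unfolding WG unfolding W_def by (metis 2 HG mult_on_assoc)
  ultimately show ?thesis
    using W moore_penrose_on_supported_iff[OF G W] GW WG tP by auto
qed

lemma pseudo_inverse_on_symmetric:
  assumes "finite S" and "\<And>x y. x \<in> S \<Longrightarrow> y \<in> S \<Longrightarrow> A x y = A y x"
  shows "moore_penrose_on S A (pseudo_inverse_on S A)"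
proof -
  \<comment> \<open>\<open>A\<close> may take any values off \<open>S\<close>, but the Penrose
    conditions see only those on \<open>S\<close>, so \<open>A\<close> can be cut off there.\<close>
  define G where "G x y = (if x \<in> S \<and> y \<in> S then A x y else 0)" for x y
  have G: "supported S G" "entry_transpose G = G"
    using assms(2) by (auto simp: supported_def G_def entry_transpose_def fun_eq_iff)
  have iff: "moore_penrose_on S A B \<longleftrightarrow> moore_penrose_on S G B" for B
    unfolding moore_penrose_on_def mult_on_def
    by (intro ball_cong refl arg_cong2[of _ _ _ _ "(\<and>)"] arg_cong2[of _ _ _ _ "(=)"] sum.cong)
       (auto simp: G_def intro!: sum.cong)
  have "\<exists>!B. moore_penrose_on S A B \<and> supported S B"
    unfolding iff using moore_penrose_exists_symmetric[OF assms(1) G]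
      moore_penrose_on_unique[OF G(1)] by blast
  then show ?thesis
    unfolding pseudo_inverse_on_def supported_def by (rule theI'[THEN conjunct1])
qed

section \<open>Tensors of partitions\<close>

text \<open>Blocks of any size are allowed because the partition into the loops of two pairings is
  treated in the same way as a pairing.\<close>

definition constant_on_blocks :: "'s set set \<Rightarrow> ('s \<Rightarrow> 'b) \<Rightarrow> bool" where
  "constant_on_blocks P i \<longleftrightarrow> (\<forall>B\<in>P. \<forall>s\<in>B. \<forall>t\<in>B. i s = i t)"

lemma constant_on_blocksD:
  "constant_on_blocks P i \<Longrightarrow> B \<in> P \<Longrightarrow> s \<in> B \<Longrightarrow> t \<in> B \<Longrightarrow> i s = i t"
  unfolding constant_on_blocks_def by blast

definition block_delta :: "'s set set \<Rightarrow> ('s \<Rightarrow> 'b) \<Rightarrow> real" where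
  "block_delta P i = of_bool (constant_on_blocks P i)"

definition pairings_on :: "'s set \<Rightarrow> 's set set set" where
  "pairings_on S = {P. partition_on S P \<and> (\<forall>B\<in>P. card B = 2)}"

lemma finite_pairings_on: "finite S \<Longrightarrow> finite (pairings_on S)"
  unfolding pairings_on_def
  by (rule finite_subset[OF _ finitely_many_partition_on[of S]]) (simp_all add: Collect_mono)

text \<open>A multi-index that is constant on the blocks amounts to a free choice of one label per
  block. The label is read off at a chosen representative, which is why the summand has to be
  expressed through these values.\<close>

lemma sum_constant_on_blocks:
  fixes g :: "('s \<Rightarrow> 'b) \<Rightarrow> 'c::comm_monoid_add"
  assumes P: "partition_on S P"
    and g: "\<And>i. i \<in> S \<rightarrow>\<^sub>E UNIV \<Longrightarrow> constant_on_blocks P i \<Longrightarrow> g i = h (\<lambda>B\<in>P. i (SOME s. s \<in> B))"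
  shows "(\<Sum>i | i \<in> S \<rightarrow>\<^sub>E UNIV \<and> constant_on_blocks P i. g i) = (\<Sum>f\<in>P \<rightarrow>\<^sub>E UNIV. h f)"
proof -
  define blk where "blk s = (THE B. B \<in> P \<and> s \<in> B)" for s
  have blk: "blk s = B" if "B \<in> P" "s \<in> B" for s B
    unfolding blk_def using that partition_onD2[OF P] disjointD by (intro the_equality) blast+
  have in_S: "s \<in> S" if "B \<in> P" "s \<in> B" for s B
    using that partition_onD1[OF P] by blast
  have S_blk: "blk s \<in> P \<and> s \<in> blk s" if "s \<in> S" for s
    using that partition_onD1[OF P] blk by blast
  have some: "(SOME s. s \<in> B) \<in> B" if "B \<in> P" for B
    using that partition_onD3[OF P] by (metis some_in_eq)
  show ?thesis
  proof (rule sum.reindex_bij_witness[of _ "\<lambda>f. \<lambda>s\<in>S. f (blk s)" "\<lambda>i. \<lambda>B\<in>P. i (SOME s. s \<in> B)"])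
    fix i :: "'s \<Rightarrow> 'b" assume i: "i \<in> {i. i \<in> S \<rightarrow>\<^sub>E UNIV \<and> constant_on_blocks P i}"
    show "(\<lambda>s\<in>S. (\<lambda>B\<in>P. i (SOME s. s \<in> B)) (blk s)) = i"
    proof
      fix s show "(\<lambda>s\<in>S. (\<lambda>B\<in>P. i (SOME s. s \<in> B)) (blk s)) s = i s"
      proof (cases "s \<in> S")
        case True
        then have b: "blk s \<in> P" "s \<in> blk s" using S_blk by auto
        have "i (SOME t. t \<in> blk s) = i s"
          using i by (intro constant_on_blocksD[OF _ b(1) some[OF b(1)] b(2)]) simp
        then show ?thesis using True b(1) by simp
      qed (use i in \<open>auto simp: PiE_def extensional_def\<close>)
    qed
    show "(\<lambda>B\<in>P. i (SOME s. s \<in> B)) \<in> P \<rightarrow>\<^sub>E UNIV" by simp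
    show "h (\<lambda>B\<in>P. i (SOME s. s \<in> B)) = g i" using g i by auto
  next
    fix f :: "'s set \<Rightarrow> 'b" assume f: "f \<in> P \<rightarrow>\<^sub>E UNIV"
    show "(\<lambda>B\<in>P. (\<lambda>s\<in>S. f (blk s)) (SOME s. s \<in> B)) = f"
    proof
      fix B show "(\<lambda>B\<in>P. (\<lambda>s\<in>S. f (blk s)) (SOME s. s \<in> B)) B = f B"
      proof (cases "B \<in> P")
        case True
        then show ?thesis using some[OF True] in_S[OF True] blk[OF True] by auto
      qed (use f in \<open>auto simp: PiE_def extensional_def\<close>)
    qed
    have "constant_on_blocks P (\<lambda>s\<in>S. f (blk s))"
      unfolding constant_on_blocks_def using in_S blk by simp
    then show "(\<lambda>s\<in>S. f (blk s)) \<in> {i. i \<in> S \<rightarrow>\<^sub>E UNIV \<and> constant_on_blocks P i}"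
      by simp
  qed
qed

lemma sum_block_delta:
  fixes g :: "('s \<Rightarrow> 'b::finite) \<Rightarrow> real"
  assumes "finite S"
  shows "(\<Sum>i\<in>S \<rightarrow>\<^sub>E UNIV. block_delta P i * g i)
    = (\<Sum>i | i \<in> S \<rightarrow>\<^sub>E UNIV \<and> constant_on_blocks P i. g i)"
  using assms by (simp add: block_delta_def finite_PiE Collect_conj_eq)

lemma prod_of_bool:
  "finite A \<Longrightarrow> (\<Prod>x\<in>A. of_bool (Q x)) = (of_bool (\<forall>x\<in>A. Q x) :: 'a::comm_semiring_1)"
  by (induction rule: finite_induct) auto

text \<open>With one free label per block the sum factors over the blocks, and a block {s, t}
  contributes the entry of u^T u = 1 at (j s, j t).\<close>

lemma sum_block_delta_orthogonal_matrix:
  fixes u :: "real^'n^'n"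
  assumes S: "finite S" and P: "P \<in> pairings_on S" and u: "orthogonal_matrix u"
  shows "(\<Sum>i\<in>S \<rightarrow>\<^sub>E UNIV. block_delta P i * (\<Prod>s\<in>S. u $ i s $ j s)) = block_delta P j"
proof -
  have part: "partition_on S P" and card2: "\<And>B. B \<in> P \<Longrightarrow> card B = 2"
    using P by (auto simp: pairings_on_def)
  have finP: "finite P" using finite_elements[OF S part] .
  have finB: "finite B" if "B \<in> P" for B using card2[OF that] by (metis card.infinite zero_neq_numeral)
  have "(\<Sum>i\<in>S \<rightarrow>\<^sub>E UNIV. block_delta P i * (\<Prod>s\<in>S. u $ i s $ j s))
    = (\<Sum>i | i \<in> S \<rightarrow>\<^sub>E UNIV \<and> constant_on_blocks P i. \<Prod>s\<in>S. u $ i s $ j s)"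
    by (rule sum_block_delta[OF S])
  also have "\<dots> = (\<Sum>f\<in>P \<rightarrow>\<^sub>E UNIV. \<Prod>B\<in>P. \<Prod>s\<in>B. u $ f B $ j s)"
  proof (rule sum_constant_on_blocks[OF part])
    fix i :: "'a \<Rightarrow> 'n" assume i: "constant_on_blocks P i"
    have "(\<Prod>s\<in>S. u $ i s $ j s) = (\<Prod>B\<in>P. \<Prod>s\<in>B. u $ i s $ j s)"
      unfolding partition_onD1[OF part]
      by (subst prod.Union_disjoint) (use finB partition_onD2[OF part] in \<open>auto simp: disjoint_def\<close>)
    also have "\<dots> = (\<Prod>B\<in>P. \<Prod>s\<in>B. u $ (\<lambda>B\<in>P. i (SOME s. s \<in> B)) B $ j s)"
    proof (intro prod.cong refl)
      fix B s assume B: "B \<in> P" "s \<in> B"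
      then have "i s = i (SOME s. s \<in> B)"
        using constant_on_blocksD[OF i B] by (metis someI)
      then show "u $ i s $ j s = u $ (\<lambda>B\<in>P. i (SOME s. s \<in> B)) B $ j s" using B by simp
    qed
    finally show "(\<Prod>s\<in>S. u $ i s $ j s) = (\<Prod>B\<in>P. \<Prod>s\<in>B. u $ (\<lambda>B\<in>P. i (SOME s. s \<in> B)) B $ j s)" .
  qed
  also have "\<dots> = (\<Prod>B\<in>P. \<Sum>x\<in>UNIV. \<Prod>s\<in>B. u $ x $ j s)"
    by (rule prod_sum_PiE[symmetric]) (auto simp: finP)
  also have "\<dots> = (\<Prod>B\<in>P. of_bool (\<forall>s\<in>B. \<forall>t\<in>B. j s = j t))"
  proof (rule prod.cong[OF refl])
    fix B assume "B \<in> P"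
    then obtain s t where st: "B = {s, t}" "s \<noteq> t"
      using card2 by (meson card_2_iff)
    have "(\<Sum>x\<in>UNIV. \<Prod>s\<in>B. u $ x $ j s) = (transpose u ** u) $ j s $ j t"
      using st by (simp add: matrix_matrix_mult_def transpose_def)
    also have "\<dots> = of_bool (j s = j t)"
      using u by (auto simp: orthogonal_matrix_def mat_def)
    also have "(j s = j t) = (\<forall>s\<in>B. \<forall>t\<in>B. j s = j t)"
      unfolding st(1) by (simp add: eq_commute)
    finally show "(\<Sum>x\<in>UNIV. \<Prod>s\<in>B. u $ x $ j s) = of_bool (\<forall>s\<in>B. \<forall>t\<in>B. j s = j t)" .
  qed
  also have "\<dots> = block_delta P j"
    unfolding block_delta_def constant_on_blocks_def by (rule prod_of_bool[OF finP])
  finally show ?thesis .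
qed

text \<open>Being constant on the blocks of both partitions means being constant on the connected
  components of their superposition, which leaves one free label per component.\<close>

lemma sum_block_delta_block_delta:
  assumes S: "finite S" and part: "partition_on S P" "partition_on S Q"
  shows "(\<Sum>i\<in>S \<rightarrow>\<^sub>E (UNIV :: 'b::finite set). block_delta P i * block_delta Q i)
    = real CARD('b) ^ card (S // {(s, t). \<exists>B\<in>P \<union> Q. s \<in> B \<and> t \<in> B}\<^sup>*)"
proof -
  define r where "r = {(s, t). \<exists>B\<in>P \<union> Q. s \<in> B \<and> t \<in> B}"
  \<comment> \<open>The closure is reflexive on the whole type; intersected with
    \<open>S \<times> S\<close> it is an equivalence relation on \<open>S\<close> with the same
    classes of elements of \<open>S\<close>.\<close>
  define R where "R = S // (r\<^sup>* \<inter> S \<times> S)"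
  have rS: "r \<subseteq> S \<times> S"
    using part[THEN partition_onD1] by (auto simp: r_def)
  have rtS: "t \<in> S" if "(s, t) \<in> r\<^sup>*" "s \<in> S" for s t
    using that(1) by (induction rule: rtrancl_induct) (use that(2) rS in auto)
  have "sym r" by (auto simp: r_def sym_def)
  then have "equiv S (r\<^sup>* \<inter> S \<times> S)"
    by (auto intro!: equivI refl_onI symI transI dest: sym_rtrancl[THEN symD])
  then have R: "partition_on S R"
    unfolding R_def by (rule partition_on_quotient)
  have RS: "S // r\<^sup>* = R"
    unfolding R_def quotient_def using rtS by auto
  have fR: "finite R" using finite_elements[OF S R] .
  have iff: "constant_on_blocks P i \<and> constant_on_blocks Q i \<longleftrightarrow> constant_on_blocks R i" for i :: "'a \<Rightarrow> 'b"
  proof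
    assume c: "constant_on_blocks P i \<and> constant_on_blocks Q i"
    have *: "i s = i t" if "(s, t) \<in> r\<^sup>*" for s t
      using that by (induction rule: rtrancl_induct) (use c in \<open>auto simp: r_def constant_on_blocks_def\<close>)
    then have "i t = i t'" if "B \<in> R" "t \<in> B" "t' \<in> B" for B t t'
    proof -
      obtain x where "B = (r\<^sup>* \<inter> S \<times> S) `` {x}"
        using \<open>B \<in> R\<close> by (auto simp: R_def elim: quotientE)
      then have "(x, t) \<in> r\<^sup>*" "(x, t') \<in> r\<^sup>*" using that by auto
      then show ?thesis using * by metis
    qed
    then show "constant_on_blocks R i" unfolding constant_on_blocks_def by meson
  next
    assume c: "constant_on_blocks R i"
    have "i s = i t" if st: "(s, t) \<in> r" for s t
    proof -
      have B: "(r\<^sup>* \<inter> S \<times> S) `` {s} \<in> R" using st rS by (auto simp: R_def quotient_def)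
      have "s \<in> (r\<^sup>* \<inter> S \<times> S) `` {s}" "t \<in> (r\<^sup>* \<inter> S \<times> S) `` {s}"
        using st rS by auto
      then show ?thesis by (rule c[unfolded constant_on_blocks_def, rule_format, OF B])
    qed
    moreover have "(s, t) \<in> r" if "B \<in> P \<union> Q" "s \<in> B" "t \<in> B" for B s t
      using that by (auto simp: r_def)
    ultimately show "constant_on_blocks P i \<and> constant_on_blocks Q i"
      unfolding constant_on_blocks_def by (meson UnI1 UnI2)
  qed
  have "(\<Sum>i\<in>S \<rightarrow>\<^sub>E (UNIV :: 'b set). block_delta P i * block_delta Q i)
    = (\<Sum>i\<in>S \<rightarrow>\<^sub>E (UNIV :: 'b set). block_delta R i * 1)"
    using iff by (intro sum.cong) (auto simp: block_delta_def)
  also have "\<dots> = (\<Sum>f\<in>R \<rightarrow>\<^sub>E (UNIV :: 'b set). 1)"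
    unfolding sum_block_delta[OF S] by (rule sum_constant_on_blocks[OF R]) simp
  also have "\<dots> = real CARD('b) ^ card R"
    using fR by (simp add: card_PiE)
  finally show ?thesis unfolding RS[symmetric] r_def .
qed

text \<open>The two relations differ only in diagonal pairs, and the reflexive closure contains
  these anyway.\<close>

lemma loops_eq:
  assumes "P \<in> pairings k" "Q \<in> pairings k"
  shows "loops k P Q = card ({1..2*k} // {(s, t). \<exists>B\<in>P \<union> Q. s \<in> B \<and> t \<in> B}\<^sup>*)"
proof -
  have "{(s, t). \<exists>B\<in>P \<union> Q. s \<in> B \<and> t \<in> B}\<^sup>* = {(s, t). {s, t} \<in> P \<union> Q}\<^sup>*"
  proof (rule subset_antisym)
    have "(s, t) \<in> {(s, t). {s, t} \<in> P \<union> Q}\<^sup>*" if "B \<in> P \<union> Q" "s \<in> B" "t \<in> B" for s t B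
    proof (cases "s = t")
      case False
      have "card B = 2" using that(1) assms by (auto simp: pairings_def)
      then obtain x y where "B = {x, y}" by (meson card_2_iff)
      then have "B = {s, t}" using that(2,3) False by auto
      then show ?thesis using that(1) by (intro r_into_rtrancl) simp
    qed simp
    then show "{(s, t). \<exists>B\<in>P \<union> Q. s \<in> B \<and> t \<in> B}\<^sup>* \<subseteq> {(s, t). {s, t} \<in> P \<union> Q}\<^sup>*"
      by (intro rtrancl_subset_rtrancl subsetI) auto
    show "{(s, t). {s, t} \<in> P \<union> Q}\<^sup>* \<subseteq> {(s, t). \<exists>B\<in>P \<union> Q. s \<in> B \<and> t \<in> B}\<^sup>*"
      by (intro rtrancl_mono) (clarsimp; blast)
  qed
  then show ?thesis unfolding loops_def by (simp only:)
qed

lemma gram_eq: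
  assumes "P \<in> pairings k" "Q \<in> pairings k"
  shows "gram k CARD('n::finite) P Q
    = (\<Sum>i\<in>{1..2*k} \<rightarrow>\<^sub>E (UNIV :: 'n set). block_delta P i * block_delta Q i)"
  unfolding gram_def loops_eq[OF assms]
  by (rule sum_block_delta_block_delta[symmetric]) (use assms in \<open>simp_all add: pairings_def\<close>)

section \<open>Infinitesimally invariant tensors\<close>

definition orth_action :: "real^'n^'n \<Rightarrow> 's set \<Rightarrow> (('s \<Rightarrow> 'n) \<Rightarrow> real) \<Rightarrow> ('s \<Rightarrow> 'n) \<Rightarrow> real" where
  "orth_action g S T i = (\<Sum>j\<in>S \<rightarrow>\<^sub>E UNIV. (\<Prod>s\<in>S. g $ i s $ j s) * T j)"

text \<open>A tensor is a function of multi-indices \<open>i \<in> S \<rightarrow>\<^sub>E UNIV\<close>, where \<open>S\<close> is the set of tensor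
  positions. \<open>unit_action a b\<close> is the Lie algebra action of a matrix unit, so the first clause of
  \<open>inf_invariant\<close> is invariance under $\mathfrak{so}_n$ and the second one is invariance under
  diagonal sign matrices.\<close>

definition unit_action :: "'n \<Rightarrow> 'n \<Rightarrow> 's set \<Rightarrow> (('s \<Rightarrow> 'n) \<Rightarrow> real) \<Rightarrow> ('s \<Rightarrow> 'n) \<Rightarrow> real" where
  "unit_action a b S T i = (\<Sum>s\<in>S. of_bool (i s = a) * T (i(s := b)))"

definition inf_invariant :: "'s set \<Rightarrow> (('s \<Rightarrow> 'n) \<Rightarrow> real) \<Rightarrow> bool" where
  "inf_invariant S T \<longleftrightarrow>
     (\<forall>a b. \<forall>i\<in>S \<rightarrow>\<^sub>E UNIV. unit_action a b S T i = unit_action b a S T i) \<and>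
     (\<forall>i\<in>S \<rightarrow>\<^sub>E UNIV. \<forall>a. odd (card {s \<in> S. i s = a}) \<longrightarrow> T i = 0)"

lemma inf_invariantD:
  assumes "inf_invariant S T" "i \<in> S \<rightarrow>\<^sub>E UNIV"
  shows "unit_action a b S T i = unit_action b a S T i"
    and "odd (card {s \<in> S. i s = a}) \<Longrightarrow> T i = 0"
  using assms unfolding inf_invariant_def by blast+

definition contract :: "'s \<Rightarrow> 's \<Rightarrow> (('s \<Rightarrow> 'n::finite) \<Rightarrow> real) \<Rightarrow> ('s \<Rightarrow> 'n) \<Rightarrow> real" where
  "contract s t T i = (\<Sum>x\<in>UNIV. T (i(s := x, t := x)))"

lemma sum_PiE_insert:
  fixes f :: "('s \<Rightarrow> 'n::finite) \<Rightarrow> 'c::comm_monoid_add"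
  assumes "s \<notin> S"
  shows "(\<Sum>i\<in>insert s S \<rightarrow>\<^sub>E UNIV. f i) = (\<Sum>i\<in>S \<rightarrow>\<^sub>E UNIV. \<Sum>x\<in>UNIV. f (i(s := x)))"
proof -
  have "(\<Sum>i\<in>insert s S \<rightarrow>\<^sub>E UNIV. f i) = (\<Sum>(x, i)\<in>UNIV \<times> (S \<rightarrow>\<^sub>E UNIV). f (i(s := x)))"
    unfolding PiE_insert_eq
    by (subst sum.reindex[OF inj_combinator[OF assms]]) (simp add: case_prod_unfold)
  also have "\<dots> = (\<Sum>i\<in>S \<rightarrow>\<^sub>E UNIV. \<Sum>x\<in>UNIV. f (i(s := x)))"
    by (subst sum.swap) (simp add: sum.cartesian_product)
  finally show ?thesis .
qed

lemma sum_PiE_remove2: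
  fixes f :: "('s \<Rightarrow> 'n::finite) \<Rightarrow> 'c::comm_monoid_add"
  assumes "s \<in> S" "t \<in> S" "s \<noteq> t"
  shows "(\<Sum>i\<in>S \<rightarrow>\<^sub>E UNIV. f i)
    = (\<Sum>i\<in>S - {s, t} \<rightarrow>\<^sub>E UNIV. \<Sum>x\<in>UNIV. \<Sum>y\<in>UNIV. f (i(s := x, t := y)))"
proof -
  have "S = insert t (insert s (S - {s, t}))" using assms by auto
  then have "(\<Sum>i\<in>S \<rightarrow>\<^sub>E UNIV. f i) = (\<Sum>i\<in>insert t (insert s (S - {s, t})) \<rightarrow>\<^sub>E UNIV. f i)"
    by simp
  also have "\<dots> = (\<Sum>i\<in>S - {s, t} \<rightarrow>\<^sub>E UNIV. \<Sum>x\<in>UNIV. \<Sum>y\<in>UNIV. f (i(s := x, t := y)))"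
    using assms by (subst sum_PiE_insert, simp, subst sum_PiE_insert) auto
  finally show ?thesis .
qed

lemma PiE_fun_upd2:
  assumes "s \<in> S" "t \<in> S" "i \<in> S - {s, t} \<rightarrow>\<^sub>E UNIV"
  shows "i(s := x, t := y) \<in> S \<rightarrow>\<^sub>E UNIV"
  using assms by (auto simp: PiE_def extensional_def)

lemma sum_of_bool_eq_mult:
  fixes f :: "'n::finite \<Rightarrow> real"
  shows "(\<Sum>x\<in>UNIV. of_bool (x = a) * f x) = f a"
  by simp

text \<open>The action on the remaining positions commutes with the contraction. The positions
  \<open>s\<close> and \<open>t\<close> contribute two extra terms, which are swapped when
  \<open>a\<close> and \<open>b\<close> are, so they cancel in the comparison.\<close>

lemma inf_invariant_contract:
  fixes T :: "('s \<Rightarrow> 'n::finite) \<Rightarrow> real"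
  assumes S: "finite S" and T: "inf_invariant S T" and st: "s \<in> S" "t \<in> S" "s \<noteq> t"
  shows "inf_invariant (S - {s, t}) (contract s t T)"
proof -
  define S' where "S' = S - {s, t}"
  have S': "S = insert s (insert t S')" "s \<notin> S'" "t \<notin> S'" "finite S'"
    using S st by (auto simp: S'_def)
  have unit: "unit_action a b S' (contract s t T) i
      = (\<Sum>x\<in>UNIV. unit_action a b S T (i(s := x, t := x))) - T (i(s := b, t := a)) - T (i(s := a, t := b))"
    for a b and i :: "'s \<Rightarrow> 'n"
  proof -
    have "(\<Sum>x\<in>UNIV. unit_action a b S T (i(s := x, t := x)))
       = (\<Sum>x\<in>UNIV. (\<Sum>r\<in>S'. of_bool (i r = a) * T ((i(r := b))(s := x, t := x)))
            + of_bool (x = a) * T (i(s := b, t := x)) + of_bool (x = a) * T (i(s := x, t := b)))"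
    proof (rule sum.cong[OF refl])
      fix x
      have "(\<Sum>r\<in>S'. of_bool ((i(s := x, t := x)) r = a) * T ((i(s := x, t := x))(r := b)))
          = (\<Sum>r\<in>S'. of_bool (i r = a) * T ((i(r := b))(s := x, t := x)))"
        using S'(2,3) by (intro sum.cong refl arg_cong2[of _ _ _ _ "(*)"] arg_cong[of _ _ T]) auto
      then show "unit_action a b S T (i(s := x, t := x))
        = (\<Sum>r\<in>S'. of_bool (i r = a) * T ((i(r := b))(s := x, t := x)))
            + of_bool (x = a) * T (i(s := b, t := x)) + of_bool (x = a) * T (i(s := x, t := b))"
        unfolding unit_action_def S'(1) using S'(2-4) st(3)
        by (simp add: fun_upd_twist del: sum_of_bool_mult_eq)
    qed
    also have "\<dots> = unit_action a b S' (contract s t T) i + T (i(s := b, t := a)) + T (i(s := a, t := b))"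
      unfolding sum.distrib sum_of_bool_eq_mult unit_action_def contract_def sum_distrib_left
      by (subst sum.swap) (rule refl)
    finally show ?thesis by simp
  qed
  have "unit_action a b S' (contract s t T) i = unit_action b a S' (contract s t T) i"
    if i: "i \<in> S' \<rightarrow>\<^sub>E UNIV" for a b i
  proof -
    have "unit_action a b S T (i(s := x, t := x)) = unit_action b a S T (i(s := x, t := x))" for x
      using inf_invariantD(1)[OF T PiE_fun_upd2[OF st(1,2) i[unfolded S'_def]]] .
    then show ?thesis by (simp add: unit)
  qed
  moreover have "contract s t T i = 0" if i: "i \<in> S' \<rightarrow>\<^sub>E UNIV" "odd (card {r \<in> S'. i r = a})" for a i
  proof -
    have "T (i(s := x, t := x)) = 0" for x
    proof -
      \<comment> \<open>The contracted pair adds two occurrences of \<open>x\<close> and none of any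
        other label, so parities are unchanged.\<close>
      have "{r \<in> S. (i(s := x, t := x)) r = a}
          = (if x = a then insert s (insert t {r \<in> S'. i r = a}) else {r \<in> S'. i r = a})"
        using S'(1-3) by auto
      then have "odd (card {r \<in> S. (i(s := x, t := x)) r = a})"
        using S' st(3) i(2) by (auto simp: card_insert_if)
      then show ?thesis
        by (rule inf_invariantD(2)[OF T PiE_fun_upd2[OF st(1,2) i(1)[unfolded S'_def]]])
    qed
    then show ?thesis by (simp add: contract_def)
  qed
  ultimately show ?thesis unfolding inf_invariant_def S'_def[symmetric] by blast
qed

lemma pairings_on_insert:
  assumes P: "P \<in> pairings_on (S - {s, t})" and st: "s \<in> S" "t \<in> S" "s \<noteq> t"
  shows "insert {s, t} P \<in> pairings_on S"
proof -
  have "partition_on S (insert {s, t} P)"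
    using P st unfolding pairings_on_def
    by (subst partition_on_insert) (auto simp: disjnt_def dest!: partition_onD1)
  then show ?thesis using P st by (auto simp: pairings_on_def)
qed

text \<open>Contraction is adjoint to adding the block {s, t}. Hence orthogonality to all pairings
  passes from a tensor to its contractions.\<close>

lemma contract_sum_block_delta:
  fixes T :: "('s \<Rightarrow> 'n::finite) \<Rightarrow> real"
  assumes P: "P \<in> pairings_on (S - {s, t})" and st: "s \<in> S" "t \<in> S" "s \<noteq> t"
  shows "(\<Sum>i\<in>S - {s, t} \<rightarrow>\<^sub>E UNIV. block_delta P i * contract s t T i)
    = (\<Sum>i\<in>S \<rightarrow>\<^sub>E UNIV. block_delta (insert {s, t} P) i * T i)"
proof -
  have P': "\<Union>P = S - {s, t}" using P by (auto simp: pairings_on_def dest: partition_onD1)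
  have *: "constant_on_blocks P (i(s := x, t := y)) = constant_on_blocks P i" for x y and i :: "'s \<Rightarrow> 'n"
    unfolding constant_on_blocks_def
  proof (intro ball_cong refl)
    fix B r r' assume "B \<in> P" "r \<in> B" "r' \<in> B"
    then have "r \<in> S - {s, t}" "r' \<in> S - {s, t}" using P' by blast+
    then show "((i(s := x, t := y)) r = (i(s := x, t := y)) r') = (i r = i r')" by simp
  qed
  have "block_delta (insert {s, t} P) (i(s := x, t := y)) = of_bool (y = x) * block_delta P i"
    for x y and i :: "'s \<Rightarrow> 'n"
  proof -
    have "constant_on_blocks (insert {s, t} P) (i(s := x, t := y))
        \<longleftrightarrow> y = x \<and> constant_on_blocks P (i(s := x, t := y))"
      unfolding constant_on_blocks_def using st(3) by auto
    then show ?thesis by (simp add: block_delta_def *)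
  qed
  then have "(\<Sum>i\<in>S \<rightarrow>\<^sub>E UNIV. block_delta (insert {s, t} P) i * T i)
    = (\<Sum>i\<in>S - {s, t} \<rightarrow>\<^sub>E UNIV. \<Sum>x\<in>UNIV. \<Sum>y\<in>UNIV. of_bool (y = x) * (block_delta P i * T (i(s := x, t := y))))"
    by (subst sum_PiE_remove2[OF st]) (simp add: mult.assoc)
  also have "\<dots> = (\<Sum>i\<in>S - {s, t} \<rightarrow>\<^sub>E UNIV. block_delta P i * contract s t T i)"
    by (simp add: sum_of_bool_eq_mult contract_def sum_distrib_left)
  finally show ?thesis by simp
qed

lemma sum_card_fibres:
  fixes i :: "'s \<Rightarrow> 'n::finite"
  assumes "finite S"
  shows "(\<Sum>a\<in>UNIV. card {s \<in> S. i s = a}) = card S"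
  using sum.group[OF assms, of UNIV i "\<lambda>_. 1::nat"] by simp

text \<open>E_ba is the adjoint of E_ab, so the left side is the sum of <T, E_ba E_ba T>. At a
  single position the sum of E_ba E_ba is the identity. At two different positions the sum of E_ba
  tensor E_ba is the quadratic form of the contraction.\<close>

lemma sum_unit_action_transposed:
  fixes T :: "('s \<Rightarrow> 'n::finite) \<Rightarrow> real"
  assumes S: "finite S"
  shows "(\<Sum>a\<in>UNIV. \<Sum>b\<in>UNIV. \<Sum>i\<in>S \<rightarrow>\<^sub>E UNIV. unit_action a b S T i * unit_action b a S T i)
    = real (card S) * (\<Sum>i\<in>S \<rightarrow>\<^sub>E UNIV. (T i)\<^sup>2)
      + (\<Sum>s\<in>S. \<Sum>t\<in>S - {s}. \<Sum>i\<in>S - {s, t} \<rightarrow>\<^sub>E UNIV. (contract s t T i)\<^sup>2)"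
proof -
  have "(\<Sum>a\<in>UNIV. \<Sum>b\<in>UNIV. \<Sum>i\<in>S \<rightarrow>\<^sub>E UNIV. unit_action a b S T i * unit_action b a S T i)
    = (\<Sum>i\<in>S \<rightarrow>\<^sub>E UNIV. \<Sum>a\<in>UNIV. \<Sum>b\<in>UNIV. unit_action a b S T i * unit_action b a S T i)"
    by (subst sum.swap[of _ _ "S \<rightarrow>\<^sub>E UNIV"], rule sum.cong[OF refl], rule sum.swap)
  also have "\<dots> = (\<Sum>i\<in>S \<rightarrow>\<^sub>E UNIV. \<Sum>s\<in>S. \<Sum>t\<in>S. T (i(s := i t)) * T (i(t := i s)))"
  proof (rule sum.cong[OF refl])
    fix i :: "'s \<Rightarrow> 'n"
    have "(\<Sum>a\<in>UNIV. \<Sum>b\<in>UNIV. unit_action a b S T i * unit_action b a S T i)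
      = (\<Sum>a\<in>UNIV. \<Sum>b\<in>UNIV. \<Sum>s\<in>S. \<Sum>t\<in>S. 
           of_bool (a = i s) * (of_bool (b = i t) * (T (i(s := b)) * T (i(t := a)))))"
      unfolding unit_action_def sum_product
      by (intro sum.cong refl) (auto simp: of_bool_def)
    also have "\<dots> = (\<Sum>s\<in>S. \<Sum>t\<in>S. \<Sum>a\<in>UNIV. \<Sum>b\<in>UNIV.
           of_bool (a = i s) * (of_bool (b = i t) * (T (i(s := b)) * T (i(t := a)))))"
      by (subst sum.swap[of _ S UNIV], subst sum.swap[of _ S UNIV], subst sum.swap[of _ S UNIV],
          subst sum.swap[of _ S UNIV], rule refl)
    also have "\<dots> = (\<Sum>s\<in>S. \<Sum>t\<in>S. T (i(s := i t)) * T (i(t := i s)))"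
      by (simp only: sum_distrib_left[symmetric] sum_of_bool_eq_mult)
    finally show "(\<Sum>a\<in>UNIV. \<Sum>b\<in>UNIV. unit_action a b S T i * unit_action b a S T i)
      = (\<Sum>s\<in>S. \<Sum>t\<in>S. T (i(s := i t)) * T (i(t := i s)))" .
  qed
  also have "\<dots> = (\<Sum>s\<in>S. \<Sum>t\<in>S. \<Sum>i\<in>S \<rightarrow>\<^sub>E UNIV. T (i(s := i t)) * T (i(t := i s)))"
    by (subst sum.swap, rule sum.cong[OF refl], rule sum.swap)
  also have "\<dots> = (\<Sum>s\<in>S. (\<Sum>i\<in>S \<rightarrow>\<^sub>E UNIV. (T i)\<^sup>2)
      + (\<Sum>t\<in>S - {s}. \<Sum>i\<in>S - {s, t} \<rightarrow>\<^sub>E UNIV. (contract s t T i)\<^sup>2))"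
  proof (rule sum.cong[OF refl])
    fix s assume s: "s \<in> S"
    have "(\<Sum>i\<in>S \<rightarrow>\<^sub>E UNIV. T (i(s := i t)) * T (i(t := i s)))
        = (\<Sum>i\<in>S - {s, t} \<rightarrow>\<^sub>E UNIV. (contract s t T i)\<^sup>2)" if t: "t \<in> S - {s}" for t
    proof -
      have [simp]: "s \<noteq> t" "t \<noteq> s" using t by auto
      \<comment> \<open>With \<open>x\<close> at \<open>s\<close> and \<open>y\<close> at
        \<open>t\<close>, one factor carries \<open>y\<close> at both places and the other one
        \<open>x\<close>, so the double sum is a square.\<close>
      have "(\<Sum>i\<in>S \<rightarrow>\<^sub>E UNIV. T (i(s := i t)) * T (i(t := i s)))
        = (\<Sum>i\<in>S - {s, t} \<rightarrow>\<^sub>E UNIV. \<Sum>x\<in>UNIV. \<Sum>y\<in>UNIV.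
             T (i(s := y, t := y)) * T (i(s := x, t := x)))"
        using s t by (subst sum_PiE_remove2[of s S t]) (auto simp: fun_upd_twist[of s t] intro!: sum.cong)
      also have "\<dots> = (\<Sum>i\<in>S - {s, t} \<rightarrow>\<^sub>E UNIV. (contract s t T i)\<^sup>2)"
        by (simp add: power2_eq_square contract_def sum_product mult.commute)
      finally show ?thesis .
    qed
    then show "(\<Sum>t\<in>S. \<Sum>i\<in>S \<rightarrow>\<^sub>E UNIV. T (i(s := i t)) * T (i(t := i s)))
      = (\<Sum>i\<in>S \<rightarrow>\<^sub>E UNIV. (T i)\<^sup>2) + (\<Sum>t\<in>S - {s}. \<Sum>i\<in>S - {s, t} \<rightarrow>\<^sub>E UNIV. (contract s t T i)\<^sup>2)"
      using S s by (subst sum.remove[of S s]) (auto simp: power2_eq_square)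
  qed
  finally show ?thesis by (simp add: sum.distrib)
qed

text \<open>The crucial point: by induction all contractions of \<open>T\<close> vanish, so
  $\sum_{a,b} \|E_{ab}T\|^2 = \sum_{a,b} \langle E_{ab}T, E_{ba}T\rangle = |S|\,\|T\|^2$. But on a
  multi-index in which $a$ occurs $m_a$ times, $E_{aa}$ acts as $m_a$, and the $m_a$ are even, so
  already the terms with $a = b$ contribute at least $2|S|\,\|T\|^2$.\<close>

lemma inf_invariant_eq_0:
  fixes T :: "('s \<Rightarrow> 'n::finite) \<Rightarrow> real"
  assumes "finite S" "inf_invariant S T"
    and "\<And>P. P \<in> pairings_on S \<Longrightarrow> (\<Sum>i\<in>S \<rightarrow>\<^sub>E UNIV. block_delta P i * T i) = 0"
    and "i \<in> S \<rightarrow>\<^sub>E UNIV"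
  shows "T i = 0"
  using assms
proof (induction S arbitrary: T i rule: finite_psubset_induct)
  case (psubset S)
  note S = \<open>finite S\<close> and T = \<open>inf_invariant S T\<close>
  show ?case
  proof (cases "S = {}")
    case True
    \<comment> \<open>Without positions there is a single multi-index, and the empty pairing
      evaluates \<open>T\<close> at it.\<close>
    have "{} \<in> pairings_on S" using True by (simp add: pairings_on_def partition_on_empty)
    from psubset.prems(2)[OF this] True psubset.prems(3) show ?thesis
      by (simp add: block_delta_def constant_on_blocks_def)
  next
    case False
    have contr: "contract s t T j = 0"
      if st: "s \<in> S" "t \<in> S" "s \<noteq> t" and j: "j \<in> S - {s, t} \<rightarrow>\<^sub>E UNIV" for s t j
    proof (rule psubset.IH[OF _ inf_invariant_contract[OF S T st] _ j])
      fix P assume "P \<in> pairings_on (S - {s, t})"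
      then show "(\<Sum>i\<in>S - {s, t} \<rightarrow>\<^sub>E UNIV. block_delta P i * contract s t T i) = 0"
        using contract_sum_block_delta[of P S s t T] st psubset.prems(2) pairings_on_insert by metis
    qed (use st in auto)
    let ?N = "\<Sum>i\<in>S \<rightarrow>\<^sub>E UNIV. (T i)\<^sup>2"
    have le: "2 * real (card S) * (T i)\<^sup>2 \<le> (\<Sum>a\<in>UNIV. (unit_action a a S T i)\<^sup>2)"
      if i: "i \<in> S \<rightarrow>\<^sub>E UNIV" for i
    proof (cases "T i = 0")
      case False
      let ?m = "\<lambda>a. card {s \<in> S. i s = a}"
      have m: "2 * real (?m a) \<le> real (?m a) ^ 2" for a
      proof -
        have "even (?m a)" using inf_invariantD(2)[OF T i] False by metis
        then have "?m a = 0 \<or> 2 \<le> ?m a" by presburger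
        then have "2 * ?m a \<le> ?m a * ?m a" by auto
        then have "real (2 * ?m a) \<le> real (?m a * ?m a)" by (simp only: of_nat_le_iff)
        then show ?thesis by (simp add: power2_eq_square)
      qed
      have "unit_action a a S T i = real (?m a) * T i" for a
      proof -
        have "unit_action a a S T i = (\<Sum>s\<in>S. of_bool (i s = a) * T i)"
          unfolding unit_action_def by (intro sum.cong) (auto simp: of_bool_def)
        then show ?thesis using S by (simp add: Int_def)
      qed
      moreover have "2 * real (card S) = (\<Sum>a\<in>UNIV. 2 * real (?m a))"
        using sum_card_fibres[OF S, of i] by (simp flip: sum_distrib_left of_nat_sum)
      ultimately show ?thesis
        using m by (auto simp: sum_distrib_right power_mult_distrib intro!: sum_mono mult_right_mono)
    qed (auto intro: sum_nonneg)
    have "2 * real (card S) * ?N \<le> (\<Sum>i\<in>S \<rightarrow>\<^sub>E UNIV. \<Sum>a\<in>UNIV. (unit_action a a S T i)\<^sup>2)"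
      using le by (auto simp: sum_distrib_left intro!: sum_mono)
    also have "\<dots> = (\<Sum>a\<in>UNIV. \<Sum>i\<in>S \<rightarrow>\<^sub>E UNIV. (unit_action a a S T i)\<^sup>2)"
      by (rule sum.swap)
    \<comment> \<open>The squares with \<open>a\<close> and \<open>b\<close> different are
      added.\<close>
    also have "\<dots> \<le> (\<Sum>a\<in>UNIV. \<Sum>b\<in>UNIV. \<Sum>i\<in>S \<rightarrow>\<^sub>E UNIV. (unit_action a b S T i)\<^sup>2)"
      by (intro sum_mono member_le_sum[of _ UNIV "\<lambda>b. \<Sum>i\<in>S \<rightarrow>\<^sub>E UNIV. (unit_action _ b S T i)\<^sup>2"] sum_nonneg) auto
    also have "\<dots> = (\<Sum>a\<in>UNIV. \<Sum>b\<in>UNIV. \<Sum>i\<in>S \<rightarrow>\<^sub>E UNIV. unit_action a b S T i * unit_action b a S T i)"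
      unfolding power2_eq_square
      by (intro sum.cong refl arg_cong2[of _ _ _ _ "(*)"] inf_invariantD(1)[OF T])
    also have "\<dots> = real (card S) * ?N"
      unfolding sum_unit_action_transposed[OF S] using contr by (auto intro!: sum.neutral)
    finally have "real (card S) * ?N \<le> 0" by simp
    moreover have "card S > 0" using S False by (simp add: card_gt_0_iff)
    ultimately have "?N \<le> 0" by (simp add: mult_le_0_iff)
    then have "?N = 0" by (intro antisym sum_nonneg) auto
    then have "\<forall>i\<in>S \<rightarrow>\<^sub>E UNIV. (T i)\<^sup>2 = 0"
      using S by (subst (asm) sum_nonneg_eq_0_iff) (auto simp: finite_PiE)
    then show ?thesis using psubset.prems(3) by simp
  qed
qed

section \<open>Invariance under the orthogonal group\<close>

lemma sum_pair_remainder: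
  fixes f :: "'n::finite \<Rightarrow> 'c::comm_monoid_add"
  assumes "a \<noteq> b"
  shows "(\<Sum>x\<in>UNIV. f x) = f a + (f b + (\<Sum>x\<in>UNIV - {a, b}. f x))"
proof -
  have "UNIV - {a} - {b} = UNIV - {a, b}" by auto
  then show ?thesis
    using assms by (simp add: sum.remove[of UNIV a] sum.remove[of "UNIV - {a}" b])
qed

text \<open>For distinct \<open>a\<close> and \<open>b\<close> this is a curve of rotations through
  the identity whose velocity there is E_ab - E_ba.\<close>

definition plane_rotation :: "'n \<Rightarrow> 'n \<Rightarrow> real \<Rightarrow> real^'n^'n" where
  "plane_rotation a b \<theta> = (\<chi> x y.
     if x = a \<and> y = a \<or> x = b \<and> y = b then cos \<theta>
     else if x = a \<and> y = b then sin \<theta>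
     else if x = b \<and> y = a then - sin \<theta>
     else of_bool (x = y))"

lemma orthogonal_plane_rotation:
  fixes a b :: "'n::finite"
  assumes "a \<noteq> b"
  shows "orthogonal_matrix (plane_rotation a b \<theta>)"
proof -
  let ?g = "plane_rotation a b \<theta>"
  have sc: "cos \<theta> * cos \<theta> + sin \<theta> * sin \<theta> = 1" "sin \<theta> * sin \<theta> + cos \<theta> * cos \<theta> = 1"
    by (simp_all flip: power2_eq_square)
  have "(\<Sum>k\<in>UNIV. ?g $ k $ x * ?g $ k $ y) = of_bool (x = y)" for x y
  proof -
    have "(\<Sum>k\<in>UNIV - {a, b}. ?g $ k $ x * ?g $ k $ y)
      = (\<Sum>k\<in>UNIV - {a, b}. if k = x then of_bool (x = y) else 0)"
      by (intro sum.cong refl) (auto simp: plane_rotation_def)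
    also have "\<dots> = of_bool (x = y \<and> x \<noteq> a \<and> x \<noteq> b)" by simp
    finally show ?thesis
      unfolding sum_pair_remainder[OF assms] using assms sc by (auto simp: plane_rotation_def)
  qed
  then show ?thesis
    by (simp add: orthogonal_matrix matrix_matrix_mult_def transpose_def mat_def vec_eq_iff)
qed

lemma plane_rotation_0: "plane_rotation a b 0 $ x $ y = of_bool (x = y)"
  by (auto simp: plane_rotation_def)

lemma has_field_derivative_plane_rotation:
  assumes "a \<noteq> b"
  shows "((\<lambda>\<theta>. plane_rotation a b \<theta> $ x $ y) has_field_derivative
    (of_bool (x = a \<and> y = b) - of_bool (x = b \<and> y = a))) (at 0)"
proof -
  consider "x = a \<and> y = a \<or> x = b \<and> y = b" | "x = a \<and> y = b" | "x = b \<and> y = a"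
    | "\<not> (x = a \<and> y = a \<or> x = b \<and> y = b)" "\<not> (x = a \<and> y = b)" "\<not> (x = b \<and> y = a)" by blast
  then show ?thesis
  proof cases
    case 1
    then show ?thesis using assms
      by (auto simp: plane_rotation_def intro!: derivative_eq_intros)
  next
    case 2
    then show ?thesis using assms
      by (auto simp: plane_rotation_def intro!: derivative_eq_intros)
  next
    case 3
    then show ?thesis using assms
      by (auto simp: plane_rotation_def intro!: derivative_eq_intros)
  next
    case 4
    then have "of_bool (x = a \<and> y = b) - of_bool (x = b \<and> y = a) = (0::real)" by auto
    moreover have "plane_rotation a b \<theta> $ x $ y = of_bool (x = y)" for \<theta>
      by (simp only: plane_rotation_def vec_lambda_beta
          if_not_P[OF 4(1)] if_not_P[OF 4(2)] if_not_P[OF 4(3)])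
    ultimately show ?thesis by simp
  qed
qed

text \<open>In the Leibniz rule for a tensor power at the identity, the undifferentiated factors are
  Kronecker deltas. Only multi-indices that agree with \<open>i\<close> away from \<open>s\<close>
  survive.\<close>

lemma sum_agree_outside:
  fixes T :: "('s \<Rightarrow> 'n::finite) \<Rightarrow> real"
  assumes S: "finite S" and s: "s \<in> S" and i: "i \<in> S \<rightarrow>\<^sub>E UNIV"
  shows "(\<Sum>j\<in>S \<rightarrow>\<^sub>E UNIV. d (j s) * (\<Prod>r\<in>S - {s}. of_bool (i r = j r)) * T j)
    = (\<Sum>y\<in>UNIV. d y * T (i(s := y)))"
proof -
  let ?S = "S - {s}" and ?i = "restrict i (S - {s})"
  have ins: "S = insert s ?S" using s by auto
  have "(\<Sum>j\<in>S \<rightarrow>\<^sub>E UNIV. d (j s) * (\<Prod>r\<in>?S. of_bool (i r = j r)) * T j)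
    = (\<Sum>j\<in>insert s ?S \<rightarrow>\<^sub>E UNIV. d (j s) * (\<Prod>r\<in>?S. of_bool (i r = j r)) * T j)"
    using ins by simp
  also have "\<dots> = (\<Sum>j\<in>?S \<rightarrow>\<^sub>E UNIV. \<Sum>y\<in>UNIV. 
      d ((j(s := y)) s) * (\<Prod>r\<in>?S. of_bool (i r = (j(s := y)) r)) * T (j(s := y)))"
    by (rule sum_PiE_insert) simp
  also have "\<dots> = (\<Sum>j\<in>?S \<rightarrow>\<^sub>E UNIV. if j = ?i then \<Sum>y\<in>UNIV. d y * T (j(s := y)) else 0)"
  proof (rule sum.cong[OF refl])
    fix j :: "'s \<Rightarrow> 'n" assume j: "j \<in> ?S \<rightarrow>\<^sub>E UNIV"
    have "(\<forall>r\<in>?S. i r = j r) \<longleftrightarrow> j = ?i"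
      using j by (auto simp: fun_eq_iff PiE_def extensional_def restrict_def)
    then have "(\<Prod>r\<in>?S. of_bool (i r = j r)) = (of_bool (j = ?i) :: real)"
      using S by (simp add: prod_of_bool)
    moreover have "(\<Prod>r\<in>?S. of_bool (i r = (j(s := y)) r)) = (\<Prod>r\<in>?S. of_bool (i r = j r) :: real)" for y
      by (intro prod.cong) auto
    ultimately show "(\<Sum>y\<in>UNIV. d ((j(s := y)) s) * (\<Prod>r\<in>?S. of_bool (i r = (j(s := y)) r)) * T (j(s := y)))
      = (if j = ?i then \<Sum>y\<in>UNIV. d y * T (j(s := y)) else 0)"
      by (simp only: fun_upd_same) simp
  qed
  also have "\<dots> = (\<Sum>y\<in>UNIV. d y * T (?i(s := y)))"
    using S by (subst sum.delta) (auto simp: finite_PiE)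
  also have "\<dots> = (\<Sum>y\<in>UNIV. d y * T (i(s := y)))"
  proof -
    have "?i(s := y) = i(s := y)" for y
      using i by (auto simp: fun_eq_iff PiE_def extensional_def restrict_def)
    then show ?thesis by simp
  qed
  finally show ?thesis .
qed

text \<open>Along plane rotations the action on \<open>T\<close> is constant, so its derivative at
  the identity vanishes. The parity condition comes from reflections.\<close>

lemma orth_invariant_imp_inf_invariant:
  fixes T :: "('s \<Rightarrow> 'n::finite) \<Rightarrow> real"
  assumes S: "finite S"
    and inv: "\<And>g i. orthogonal_matrix g \<Longrightarrow> i \<in> S \<rightarrow>\<^sub>E UNIV \<Longrightarrow> orth_action g S T i = T i"
  shows "inf_invariant S T"
  unfolding inf_invariant_def
proof (intro conjI ballI allI impI)
  fix a b :: 'n and i :: "'s \<Rightarrow> 'n" assume i: "i \<in> S \<rightarrow>\<^sub>E UNIV"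
  show "unit_action a b S T i = unit_action b a S T i"
  proof (cases "a = b")
    case False
    let ?g = "plane_rotation a b"
    define d where "d x y = (of_bool (x = a \<and> y = b) - of_bool (x = b \<and> y = a) :: real)" for x y
    have "((\<lambda>\<theta>. orth_action (?g \<theta>) S T i) has_field_derivative
       (\<Sum>j\<in>S \<rightarrow>\<^sub>E UNIV. (\<Sum>s\<in>S. d (i s) (j s) * (\<Prod>r\<in>S - {s}. ?g 0 $ i r $ j r)) * T j)) (at 0)"
      unfolding orth_action_def d_def
      by (intro DERIV_sum DERIV_cmult_right has_field_derivative_prod has_field_derivative_plane_rotation False)
    moreover have "(\<lambda>\<theta>. orth_action (?g \<theta>) S T i) = (\<lambda>\<theta>. T i)"
      using inv[OF orthogonal_plane_rotation[OF False] i] by simp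
    ultimately have "0 = (\<Sum>j\<in>S \<rightarrow>\<^sub>E UNIV. (\<Sum>s\<in>S. d (i s) (j s) * (\<Prod>r\<in>S - {s}. of_bool (i r = j r))) * T j)"
      using DERIV_unique[OF DERIV_const[of "T i" "at 0"]] by (simp add: plane_rotation_0)
    also have "\<dots> = (\<Sum>s\<in>S. \<Sum>j\<in>S \<rightarrow>\<^sub>E UNIV. d (i s) (j s) * (\<Prod>r\<in>S - {s}. of_bool (i r = j r)) * T j)"
      by (subst sum.swap) (simp only: sum_distrib_right)
    also have "\<dots> = (\<Sum>s\<in>S. \<Sum>y\<in>UNIV. d (i s) y * T (i(s := y)))"
      by (intro sum.cong refl sum_agree_outside S i)
    also have "\<dots> = (\<Sum>s\<in>S. of_bool (i s = a) * T (i(s := b)) - of_bool (i s = b) * T (i(s := a)))"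
    proof (rule sum.cong[OF refl])
      fix s
      have "(\<Sum>y\<in>UNIV. d (i s) y * T (i(s := y)))
        = (\<Sum>y\<in>UNIV. of_bool (y = b) * (of_bool (i s = a) * T (i(s := y)))
             - of_bool (y = a) * (of_bool (i s = b) * T (i(s := y))))"
        by (intro sum.cong) (auto simp: d_def)
      then show "(\<Sum>y\<in>UNIV. d (i s) y * T (i(s := y)))
        = of_bool (i s = a) * T (i(s := b)) - of_bool (i s = b) * T (i(s := a))"
        by (simp only: sum_subtractf sum_of_bool_eq_mult)
    qed
    finally show ?thesis by (simp only: unit_action_def sum_subtractf)
  qed simp
next
  fix i :: "'s \<Rightarrow> 'n" and a :: 'n assume i: "i \<in> S \<rightarrow>\<^sub>E UNIV" and odd: "odd (card {s \<in> S. i s = a})"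
  \<comment> \<open>The reflection of coordinate \<open>a\<close> multiplies the entry at
    \<open>i\<close> by -1 once for each occurrence of \<open>a\<close>.\<close>
  define g :: "real^'n^'n" where "g = (\<chi> x y. if x = y then if x = a then - 1 else 1 else 0)"
  have "(\<Sum>k\<in>UNIV. g $ k $ x * g $ k $ y) = of_bool (x = y)" for x y
  proof -
    have "(\<Sum>k\<in>UNIV. g $ k $ x * g $ k $ y) = (\<Sum>k\<in>UNIV. if k = x then of_bool (x = y) else 0)"
      by (intro sum.cong) (auto simp: g_def)
    then show ?thesis by simp
  qed
  then have g: "orthogonal_matrix g"
    by (simp add: orthogonal_matrix matrix_matrix_mult_def transpose_def mat_def vec_eq_iff)
  have "orth_action g S T i = (\<Sum>j\<in>S \<rightarrow>\<^sub>E UNIV. if j = i then - T i else 0)"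
    unfolding orth_action_def
  proof (rule sum.cong[OF refl])
    fix j :: "'s \<Rightarrow> 'n" assume j: "j \<in> S \<rightarrow>\<^sub>E UNIV"
    show "(\<Prod>s\<in>S. g $ i s $ j s) * T j = (if j = i then - T i else 0)"
    proof (cases "j = i")
      case True
      have "(\<Prod>s\<in>S. g $ i s $ i s) = (\<Prod>s\<in>S. if i s = a then - 1 else 1)"
        by (simp add: g_def)
      also have "\<dots> = (- 1) ^ card {s \<in> S. i s = a}"
        using S by (simp add: prod.If_cases Int_def)
      also have "\<dots> = - 1" using odd by simp
      finally show ?thesis using True by simp
    next
      case False
      then obtain s where "s \<in> S" "i s \<noteq> j s" using PiE_ext[OF i j] by metis
      then have "(\<Prod>s\<in>S. g $ i s $ j s) = 0"
        using S by (intro prod_zero) (auto simp: g_def)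
      then show ?thesis using False by simp
    qed
  qed
  also have "\<dots> = - T i" using S i by (simp add: finite_PiE)
  finally show "T i = 0" using inv[OF g i] by simp
qed

text \<open>The action sums over column indices, hence the orthogonality relation is applied to the
  transpose of \<open>g\<close>.\<close>

lemma orth_action_block_delta:
  assumes "finite S" "P \<in> pairings_on S" "orthogonal_matrix g"
  shows "orth_action g S (block_delta P) i = block_delta P i"
proof -
  have "orthogonal_matrix (transpose g)" using assms(3) by simp
  from sum_block_delta_orthogonal_matrix[OF assms(1,2) this, of i] show ?thesis
    by (simp add: orth_action_def transpose_def mult.commute)
qed

section \<open>Moments of Haar measure\<close>

context
  fixes \<mu> :: "(real^'n::finite^'n) measure"
  assumes haar: "normalized_haar_orthogonal \<mu>"
begin

lemma haar_prob_space: "prob_space \<mu>"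
  and haar_sets: "sets \<mu> = sets (restrict_space borel {u. orthogonal_matrix u})"
  using haar by (auto simp: normalized_haar_orthogonal_def)

lemma haar_space: "space \<mu> = {u. orthogonal_matrix u}"
  using sets_eq_imp_space_eq[OF haar_sets] by (simp add: space_restrict_space)

lemma haar_measurable_mult:
  assumes g: "orthogonal_matrix g"
  shows "(\<lambda>u. g ** u) \<in> measurable \<mu> \<mu>"
proof -
  have "(\<lambda>u. g ** u) \<in> borel_measurable borel"
    unfolding matrix_matrix_mult_def
    by (intro borel_measurable_continuous_onI continuous_intros)
  then have "(\<lambda>u. g ** u) \<in> measurable (restrict_space borel {u. orthogonal_matrix u})
      (restrict_space borel {u. orthogonal_matrix u})"
    using g by (intro measurable_restrict_space2 measurable_restrict_space1)
      (auto simp: space_restrict_space orthogonal_matrix_mul)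
  then show ?thesis by (subst measurable_cong_sets[OF haar_sets haar_sets])
qed

text \<open>Invariance is given for images of sets, and the preimage under \<open>g\<close> is the
  image under its transpose.\<close>

lemma haar_distr:
  assumes g: "orthogonal_matrix g"
  shows "distr \<mu> \<mu> (\<lambda>u. g ** u) = \<mu>"
proof (rule measure_eqI)
  fix A assume "A \<in> sets (distr \<mu> \<mu> (\<lambda>u. g ** u))"
  then have A: "A \<in> sets \<mu>" by simp
  have gt: "orthogonal_matrix (transpose g)" using g by simp
  have inv: "g ** (transpose g ** u) = u" "transpose g ** (g ** u) = u" for u :: "real^'n^'n"
    using g by (simp_all add: orthogonal_matrix_def matrix_mul_assoc)
  have sub: "A \<subseteq> {u. orthogonal_matrix u}" using sets.sets_into_space[OF A] haar_space by simp
  have "(\<lambda>u. g ** u) -` A \<inter> space \<mu> = (\<lambda>u. transpose g ** u) ` A"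
  proof (intro equalityI subsetI)
    fix u assume "u \<in> (\<lambda>u. g ** u) -` A \<inter> space \<mu>"
    then show "u \<in> (\<lambda>u. transpose g ** u) ` A" using inv(2)[of u] by (intro image_eqI) auto
  next
    fix u assume "u \<in> (\<lambda>u. transpose g ** u) ` A"
    then obtain v where "v \<in> A" "u = transpose g ** v" by auto
    then show "u \<in> (\<lambda>u. g ** u) -` A \<inter> space \<mu>"
      using inv(1) sub gt by (auto simp: haar_space orthogonal_matrix_mul)
  qed
  then have "emeasure (distr \<mu> \<mu> (\<lambda>u. g ** u)) A = emeasure \<mu> ((\<lambda>u. transpose g ** u) ` A)"
    using A by (simp add: emeasure_distr haar_measurable_mult[OF g])
  also have "\<dots> = emeasure \<mu> A"
    using haar gt A unfolding normalized_haar_orthogonal_def by blast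
  finally show "emeasure (distr \<mu> \<mu> (\<lambda>u. g ** u)) A = emeasure \<mu> A" .
qed simp

lemma haar_integral_mult:
  fixes f :: "real^'n^'n \<Rightarrow> real"
  assumes "f \<in> borel_measurable \<mu>" "orthogonal_matrix g"
  shows "(\<integral>u. f (g ** u) \<partial>\<mu>) = (\<integral>u. f u \<partial>\<mu>)"
  using integral_distr[OF haar_measurable_mult[OF assms(2)] assms(1)] haar_distr[OF assms(2)] by simp

lemma haar_measurable_monomial:
  "(\<lambda>u. \<Prod>s\<in>S. u $ i s $ j s) \<in> borel_measurable \<mu>"
proof -
  have "(\<lambda>u :: real^'n^'n. \<Prod>s\<in>S. u $ i s $ j s) \<in> borel_measurable borel"
    by (intro borel_measurable_continuous_onI continuous_intros)
  then have "(\<lambda>u :: real^'n^'n. \<Prod>s\<in>S. u $ i s $ j s)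
      \<in> borel_measurable (restrict_space borel {u. orthogonal_matrix u})"
    by (rule measurable_restrict_space1)
  then show ?thesis by (subst measurable_cong_sets[OF haar_sets refl])
qed

text \<open>Columns of an orthogonal matrix are unit vectors, so all entries, and hence all
  monomials, are bounded by 1.\<close>

lemma haar_integrable_monomial:
  "integrable \<mu> (\<lambda>u. \<Prod>s\<in>S. u $ i s $ j s)"
proof -
  interpret prob_space \<mu> by (rule haar_prob_space)
  have "\<bar>u $ x $ y\<bar> \<le> 1" if "orthogonal_matrix u" for u :: "real^'n^'n" and x y
  proof -
    have "norm (column y u) = 1" using that by (simp add: orthogonal_matrix_orthonormal_columns)
    then show ?thesis using component_le_norm_cart[of "column y u" x] by (simp add: column_def)
  qed
  then have "AE u in \<mu>. norm (\<Prod>s\<in>S. u $ i s $ j s) \<le> 1"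
    by (intro AE_I2) (auto simp: haar_space abs_prod intro!: prod_le_1)
  then show ?thesis
    by (rule integrable_const_bound[OF _ haar_measurable_monomial])
qed

text \<open>Left translation mixes the rows of \<open>u\<close> and leaves its column indices alone,
  so \<open>j\<close> stays fixed and the moment is a tensor in \<open>i\<close>.\<close>

lemma orth_action_moment:
  assumes S: "finite S" and g: "orthogonal_matrix g"
  shows "orth_action g S (\<lambda>i. \<integral>u. (\<Prod>s\<in>S. u $ i s $ j s) \<partial>\<mu>) i = (\<integral>u. (\<Prod>s\<in>S. u $ i s $ j s) \<partial>\<mu>)"
proof -
  have "orth_action g S (\<lambda>i. \<integral>u. (\<Prod>s\<in>S. u $ i s $ j s) \<partial>\<mu>) i
    = (\<integral>u. (\<Sum>i'\<in>S \<rightarrow>\<^sub>E UNIV. (\<Prod>s\<in>S. g $ i s $ i' s) * (\<Prod>s\<in>S. u $ i' s $ j s)) \<partial>\<mu>)"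
    unfolding orth_action_def
    by (subst Bochner_Integration.integral_sum) (simp_all add: haar_integrable_monomial)
  also have "\<dots> = (\<integral>u. (\<Prod>s\<in>S. (g ** u) $ i s $ j s) \<partial>\<mu>)"
  proof (rule Bochner_Integration.integral_cong[OF refl])
    fix u
    have "(\<Prod>s\<in>S. (g ** u) $ i s $ j s) = (\<Prod>s\<in>S. \<Sum>x\<in>UNIV. g $ i s $ x * u $ x $ j s)"
      by (simp add: matrix_matrix_mult_def)
    also have "\<dots> = (\<Sum>i'\<in>S \<rightarrow>\<^sub>E UNIV. \<Prod>s\<in>S. g $ i s $ i' s * u $ i' s $ j s)"
      using S by (intro prod_sum_PiE) auto
    finally show "(\<Sum>i'\<in>S \<rightarrow>\<^sub>E UNIV. (\<Prod>s\<in>S. g $ i s $ i' s) * (\<Prod>s\<in>S. u $ i' s $ j s))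
      = (\<Prod>s\<in>S. (g ** u) $ i s $ j s)"
      by (simp only: prod.distrib)
  qed
  also have "\<dots> = (\<integral>u. (\<Prod>s\<in>S. u $ i s $ j s) \<partial>\<mu>)"
    by (rule haar_integral_mult[OF haar_measurable_monomial g])
  finally show ?thesis .
qed

text \<open>The sum is already constant in \<open>u\<close> on the orthogonal group, before
  integration.\<close>

lemma sum_block_delta_moment:
  assumes S: "finite S" and P: "P \<in> pairings_on S"
  shows "(\<Sum>i\<in>S \<rightarrow>\<^sub>E UNIV. block_delta P i * (\<integral>u. (\<Prod>s\<in>S. u $ i s $ j s) \<partial>\<mu>)) = block_delta P j"
proof -
  interpret prob_space \<mu> by (rule haar_prob_space)
  have "(\<Sum>i\<in>S \<rightarrow>\<^sub>E UNIV. block_delta P i * (\<integral>u. (\<Prod>s\<in>S. u $ i s $ j s) \<partial>\<mu>))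
    = (\<integral>u. (\<Sum>i\<in>S \<rightarrow>\<^sub>E UNIV. block_delta P i * (\<Prod>s\<in>S. u $ i s $ j s)) \<partial>\<mu>)"
    by (subst Bochner_Integration.integral_sum) (simp_all add: haar_integrable_monomial)
  also have "\<dots> = (\<integral>u. block_delta P j \<partial>\<mu>)"
    by (rule Bochner_Integration.integral_cong[OF refl])
       (simp only: haar_space mem_Collect_eq sum_block_delta_orthogonal_matrix[OF S P])
  also have "\<dots> = block_delta P j" by (simp add: prob_space)
  finally show ?thesis .
qed

end

section \<open>The Weingarten formula\<close>

lemma pairings_eq: "pairings k = pairings_on {1..2*k}"
  by (simp add: pairings_def pairings_on_def)

lemma weingarten_gram_weingarten:
  assumes PQ: "P \<in> pairings k" "Q \<in> pairings k"
  shows "mult_on (pairings k) (mult_on (pairings k) (gram k n) (weingarten k n)) (gram k n) P Q = gram k n P Q"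
proof -
  have "gram k n X Y = gram k n Y X" for X Y
    by (simp add: gram_def loops_def Un_commute)
  then have "moore_penrose_on (pairings k) (gram k n) (weingarten k n)"
    unfolding weingarten_def
    by (intro pseudo_inverse_on_symmetric) (simp_all add: pairings_eq finite_pairings_on)
  then show ?thesis using PQ by (simp add: moore_penrose_on_def)
qed

text \<open>G W acts as the identity on the vector of values of the pairing tensors at
  \<open>j\<close>, although it need not be the identity matrix. The difference \<open>v\<close> of
  the two sides is a combination of pairing tensors, and \<open>G W G = G\<close> makes it
  orthogonal to all of them.\<close>

lemma sum_gram_weingarten_block_delta:
  fixes j :: "nat \<Rightarrow> 'n::finite"
  assumes P: "P \<in> pairings k" and j: "j \<in> {1..2*k} \<rightarrow>\<^sub>E UNIV"
  shows "(\<Sum>Q\<in>pairings k. mult_on (pairings k) (gram k CARD('n)) (weingarten k CARD('n)) P Q * block_delta Q j)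
    = block_delta P j"
proof -
  let ?I = "{1..2*k} \<rightarrow>\<^sub>E (UNIV :: 'n set)"
  define M where "M = mult_on (pairings k) (gram k CARD('n)) (weingarten k CARD('n))"
  define v where "v j = block_delta P j - (\<Sum>Q\<in>pairings k. M P Q * block_delta Q j)" for j :: "nat \<Rightarrow> 'n"
  have fin: "finite ?I" by (simp add: finite_PiE)
  have orth: "(\<Sum>j\<in>?I. v j * block_delta R j) = 0" if R: "R \<in> pairings k" for R
  proof -
    have "(\<Sum>j\<in>?I. v j * block_delta R j)
      = (\<Sum>j\<in>?I. block_delta P j * block_delta R j)
        - (\<Sum>j\<in>?I. \<Sum>Q\<in>pairings k. M P Q * (block_delta Q j * block_delta R j))"
      by (simp only: v_def left_diff_distrib sum_subtractf sum_distrib_right mult.assoc)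
    also have "(\<Sum>j\<in>?I. \<Sum>Q\<in>pairings k. M P Q * (block_delta Q j * block_delta R j))
      = (\<Sum>Q\<in>pairings k. M P Q * (\<Sum>j\<in>?I. block_delta Q j * block_delta R j))"
      by (subst sum.swap) (simp only: sum_distrib_left)
    also have "\<dots> = (\<Sum>Q\<in>pairings k. M P Q * gram k CARD('n) Q R)"
      using R by (intro sum.cong refl) (simp only: gram_eq)
    also have "\<dots> = gram k CARD('n) P R"
      using weingarten_gram_weingarten[OF P R, of "CARD('n)"]
      by (subst (asm) mult_on_def) (simp only: M_def)
    also have "(\<Sum>j\<in>?I. block_delta P j * block_delta R j) = gram k CARD('n) P R"
      by (rule gram_eq[OF P R, symmetric])
    finally show ?thesis by simp
  qed
  \<comment> \<open>Expanding one factor of the squared norm leaves only scalar products of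
    \<open>v\<close> with pairing tensors.\<close>
  have "(\<Sum>j\<in>?I. v j * v j)
    = (\<Sum>j\<in>?I. v j * block_delta P j) - (\<Sum>j\<in>?I. \<Sum>Q\<in>pairings k. M P Q * (v j * block_delta Q j))"
    by (subst (2) v_def) (simp only: right_diff_distrib sum_subtractf sum_distrib_left mult.left_commute)
  also have "(\<Sum>j\<in>?I. \<Sum>Q\<in>pairings k. M P Q * (v j * block_delta Q j))
      = (\<Sum>Q\<in>pairings k. M P Q * (\<Sum>j\<in>?I. v j * block_delta Q j))"
    by (subst sum.swap) (simp only: sum_distrib_left)
  finally have "(\<Sum>j\<in>?I. v j * v j) = 0" using orth P by simp
  then have "v j * v j = 0"
    using fin j by (subst (asm) sum_nonneg_eq_0_iff) auto
  then show ?thesis by (simp add: v_def M_def)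
qed

lemma weingarten_formula:
  fixes i j :: "nat \<Rightarrow> 'n::finite" and \<mu> :: "(real^'n^'n) measure"
  assumes haar: "normalized_haar_orthogonal \<mu>"
    and i: "i \<in> {1..2*k} \<rightarrow>\<^sub>E UNIV" and j: "j \<in> {1..2*k} \<rightarrow>\<^sub>E UNIV"
  shows "(\<integral>u. (\<Prod>s\<in>{1..2*k}. u $ i s $ j s) \<partial>\<mu>)
    = (\<Sum>P\<in>pairings k. \<Sum>Q\<in>pairings k. block_delta P i * block_delta Q j * weingarten k CARD('n) P Q)"
proof -
  let ?S = "{1..2*k}"
  \<comment> \<open>The coefficients of the right hand side as a combination of the pairing tensors
    in the row indices.\<close>
  define c where "c P = (\<Sum>Q\<in>pairings k. weingarten k CARD('n) P Q * block_delta Q j)" for P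
  define m where "m = (\<lambda>i :: nat \<Rightarrow> 'n. \<integral>u. (\<Prod>s\<in>?S. u $ i s $ j s) \<partial>\<mu>)"
  define T where "T i = m i - (\<Sum>P\<in>pairings k. c P * block_delta P i)" for i :: "nat \<Rightarrow> 'n"
  have "orth_action g ?S T i = T i" if g: "orthogonal_matrix g" for g i
  proof -
    have "orth_action g ?S T i = orth_action g ?S m i - (\<Sum>P\<in>pairings k. c P * orth_action g ?S (block_delta P) i)"
    proof -
      have "(\<Sum>i'\<in>?S \<rightarrow>\<^sub>E UNIV. \<Sum>P\<in>pairings k. (\<Prod>s\<in>?S. g $ i s $ i' s) * (c P * block_delta P i'))
        = (\<Sum>P\<in>pairings k. \<Sum>i'\<in>?S \<rightarrow>\<^sub>E UNIV. c P * ((\<Prod>s\<in>?S. g $ i s $ i' s) * block_delta P i'))"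
        by (subst sum.swap) (simp only: mult.left_commute)
      then show ?thesis
        unfolding orth_action_def T_def
        by (simp only: right_diff_distrib sum_subtractf sum_distrib_left)
    qed
    also have "orth_action g ?S m i = m i"
      unfolding m_def by (rule orth_action_moment[OF haar _ g]) simp
    also have "(\<Sum>P\<in>pairings k. c P * orth_action g ?S (block_delta P) i) = (\<Sum>P\<in>pairings k. c P * block_delta P i)"
      using g by (intro sum.cong refl) (simp add: orth_action_block_delta pairings_eq)
    finally show ?thesis by (simp only: T_def[of i])
  qed
  then have inv: "inf_invariant ?S T"
    by (intro orth_invariant_imp_inf_invariant) simp_all
  have "T i = 0"
  proof (rule inf_invariant_eq_0[OF _ inv _ i])
    fix P assume "P \<in> pairings_on ?S"
    then have P: "P \<in> pairings k" by (simp add: pairings_eq)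
    have "(\<Sum>i\<in>?S \<rightarrow>\<^sub>E (UNIV :: 'n set). block_delta P i * T i)
      = (\<Sum>i\<in>?S \<rightarrow>\<^sub>E (UNIV :: 'n set). block_delta P i * m i)
        - (\<Sum>i\<in>?S \<rightarrow>\<^sub>E (UNIV :: 'n set). \<Sum>R\<in>pairings k. c R * (block_delta P i * block_delta R i))"
      by (simp only: T_def right_diff_distrib sum_subtractf sum_distrib_left mult.left_commute)
    also have "(\<Sum>i\<in>?S \<rightarrow>\<^sub>E (UNIV :: 'n set). block_delta P i * m i) = block_delta P j"
      unfolding m_def using P by (intro sum_block_delta_moment[OF haar]) (simp_all add: pairings_eq)
    also have "(\<Sum>i\<in>?S \<rightarrow>\<^sub>E (UNIV :: 'n set). \<Sum>R\<in>pairings k. c R * (block_delta P i * block_delta R i))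
      = (\<Sum>R\<in>pairings k. c R * (\<Sum>i\<in>?S \<rightarrow>\<^sub>E (UNIV :: 'n set). block_delta P i * block_delta R i))"
      by (subst sum.swap) (simp only: sum_distrib_left)
    also have "\<dots> = (\<Sum>R\<in>pairings k. c R * gram k CARD('n) P R)"
      using P by (intro sum.cong refl) (simp only: gram_eq)
    also have "\<dots> = (\<Sum>R\<in>pairings k. \<Sum>Q\<in>pairings k.
        gram k CARD('n) P R * weingarten k CARD('n) R Q * block_delta Q j)"
      by (simp only: c_def sum_distrib_left sum_distrib_right mult_ac)
    also have "\<dots> = (\<Sum>Q\<in>pairings k.
        mult_on (pairings k) (gram k CARD('n)) (weingarten k CARD('n)) P Q * block_delta Q j)"
      by (subst sum.swap) (simp only: mult_on_def sum_distrib_right)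
    also have "\<dots> = block_delta P j"
      by (rule sum_gram_weingarten_block_delta[OF P j])
    finally show "(\<Sum>i\<in>?S \<rightarrow>\<^sub>E (UNIV :: 'n set). block_delta P i * T i) = 0" by simp
  qed simp
  then show ?thesis
    by (simp add: T_def m_def c_def sum_distrib_left sum_distrib_right mult_ac)
qed

text \<open>Both multi-indices are projections of this one list, so its positions correspond to the
  factors of the monomial.\<close>

definition index_pairs :: "nat \<Rightarrow> nat \<Rightarrow> (nat \<Rightarrow> nat \<Rightarrow> nat) \<Rightarrow> (nat \<times> nat) list" where
  "index_pairs p q a =
     concat (map (\<lambda>i. concat (map (\<lambda>j. replicate (a i j) (i, j)) [1..<Suc q])) [1..<Suc p])"

lemma left_index_eq: "left_index p q a = map fst (index_pairs p q a)"
  by (simp add: left_index_def index_pairs_def map_concat comp_def)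

lemma right_index_eq: "right_index p q a = map snd (index_pairs p q a)"
  by (simp add: right_index_def index_pairs_def map_concat comp_def)

lemma set_index_pairs: "set (index_pairs p q a) \<subseteq> {1..p} \<times> {1..q}"
  by (auto simp: index_pairs_def)

lemma sum_list_upt: "sum_list (map f [1..<Suc m]) = (\<Sum>i=1..m. f i :: nat)"
  by (induction m) auto

lemma length_index_pairs: "length (index_pairs p q a) = (\<Sum>i=1..p. \<Sum>j=1..q. a i j)"
  by (simp add: index_pairs_def length_concat comp_def sum_list_upt del: upt_Suc One_nat_def)

lemma prod_list_concat: "prod_list (concat xss) = prod_list (map prod_list xss)"
  by (induction xss) simp_all

lemma prod_list_replicate: "prod_list (replicate m x) = x ^ m"
  by (induction m) simp_all

lemma prod_list_upt: "prod_list (map f [1..<Suc m]) = (\<Prod>i=1..m. f i :: real)"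
  by (induction m) (auto simp: mult.commute)

lemma prod_index_pairs:
  "(\<Prod>s\<in>{1..length (index_pairs p q a)}. f (index_pairs p q a ! (s - 1)))
    = (\<Prod>i=1..p. \<Prod>j=1..q. f (i, j) ^ a i j :: real)"
proof -
  \<comment> \<open>Tensor positions start at 1, list positions at 0.\<close>
  have "(\<Prod>s\<in>{1..length xs}. f (xs ! (s - 1))) = prod_list (map f xs)" for xs
    unfolding prod_list_upt[symmetric]
    by (rule arg_cong[of _ _ prod_list]) (auto intro!: nth_equalityI simp del: upt_Suc)
  then show ?thesis
    by (simp add: index_pairs_def map_concat comp_def prod_list_concat prod_list_replicate
        prod_list_upt del: upt_Suc One_nat_def)
qed

text \<open>Injective relabelling of the entries neither creates nor destroys equalities between
  them.\<close>

lemma pairing_delta_eq_block_delta: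
  assumes P: "P \<in> pairings k" and len: "length xs = 2 * k"
    and e: "inj_on e A" "set xs \<subseteq> A"
  shows "pairing_delta P xs = block_delta P (\<lambda>s\<in>{1..2*k}. e (xs ! (s - 1)))"
proof -
  let ?i = "\<lambda>s\<in>{1..2*k}. e (xs ! (s - 1))"
  have sub: "s \<in> {1..2*k}" if "B \<in> P" "s \<in> B" for B s
    using that P partition_onD1[of "{1..2*k}" P] by (auto simp: pairings_def)
  have eq: "?i s = ?i t \<longleftrightarrow> xs ! (s - 1) = xs ! (t - 1)" if "s \<in> {1..2*k}" "t \<in> {1..2*k}" for s t
  proof -
    have "xs ! (s - 1) \<in> A" "xs ! (t - 1) \<in> A" using that e(2) len by (auto intro!: subsetD[OF e(2)] nth_mem)
    then show ?thesis using that inj_on_eq_iff[OF e(1)] by simp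
  qed
  have "constant_on_blocks P ?i \<longleftrightarrow> (\<forall>s t. {s, t} \<in> P \<longrightarrow> xs ! (s - 1) = xs ! (t - 1))"
  proof (intro iffI allI impI)
    fix s t assume "constant_on_blocks P ?i" and st: "{s, t} \<in> P"
    then have "?i s = ?i t" by (intro constant_on_blocksD[of P ?i "{s, t}"]) auto
    then show "xs ! (s - 1) = xs ! (t - 1)" using eq sub[OF st] by blast
  next
    assume *: "\<forall>s t. {s, t} \<in> P \<longrightarrow> xs ! (s - 1) = xs ! (t - 1)"
    show "constant_on_blocks P ?i"
      unfolding constant_on_blocks_def
    proof (intro ballI)
      fix B s t assume B: "B \<in> P" "s \<in> B" "t \<in> B"
      show "?i s = ?i t"
      \<comment> \<open>Only distinct \<open>s\<close> and \<open>t\<close> exhaust their block, so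
        only for them does the hypothesis on {s, t} apply.\<close>
      proof (cases "s = t")
        case False
        have "card B = 2" using P B(1) by (simp add: pairings_def)
        then obtain x y where "B = {x, y}" by (meson card_2_iff)
        then have "B = {s, t}" using B(2,3) False by auto
        then have "xs ! (s - 1) = xs ! (t - 1)" using * B(1) by metis
        then show ?thesis using eq[OF sub[OF B(1,2)] sub[OF B(1,3)]] by blast
      qed simp
    qed
  qed
  then show ?thesis by (simp add: pairing_delta_def block_delta_def of_bool_def)
qed

theorem theorem2p2:
  fixes p q n k :: nat
    and a :: "nat \<Rightarrow> nat \<Rightarrow> nat"
    and e :: "nat \<Rightarrow> 'n::finite"
    and \<mu> :: "(real^'n^'n) measure"
  assumes "p \<ge> 1" and "q \<ge> 1" and "n \<ge> p" and "n \<ge> q"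
    and "bij_betw e {1..n} (UNIV :: 'n set)"
    and "normalized_haar_orthogonal \<mu>"
    and "even (\<Sum>i=1..p. \<Sum>j=1..q. a i j)"
    and "k = (\<Sum>i=1..p. \<Sum>j=1..q. a i j) div 2"
  shows "(\<integral>u. (\<Prod>i=1..p. \<Prod>j=1..q. (u $ e i $ e j) ^ a i j) \<partial>\<mu>) =
    (\<Sum>\<pi>\<in>pairings k. \<Sum>\<sigma>\<in>pairings k.
       pairing_delta \<pi> (left_index p q a) * pairing_delta \<sigma> (right_index p q a) *
       weingarten k n \<pi> \<sigma>)"
proof -
  let ?zs = "index_pairs p q a"
  have n: "CARD('n) = n" using bij_betw_same_card[OF assms(5)] by simp
  have inj: "inj_on e {1..n}" using assms(5) by (rule bij_betw_imp_inj_on)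
  have len: "length ?zs = 2 * k" using assms(7,8) by (simp add: length_index_pairs)
  \<comment> \<open>Multi-indices are extensional functions on the positions, hence the
    restriction.\<close>
  define l where "l = (\<lambda>s\<in>{1..2*k}. e (left_index p q a ! (s - 1)))"
  define r where "r = (\<lambda>s\<in>{1..2*k}. e (right_index p q a ! (s - 1)))"
  \<comment> \<open>Row labels are at most \<open>p\<close>, hence at most \<open>n\<close>, and
    \<open>e\<close> is injective there.\<close>
  have "pairing_delta P (left_index p q a) = block_delta P l" if "P \<in> pairings k" for P
    unfolding l_def using that len inj set_index_pairs[of p q a] assms(3)
    by (intro pairing_delta_eq_block_delta) (auto simp: left_index_eq)
  moreover have "pairing_delta P (right_index p q a) = block_delta P r" if "P \<in> pairings k" for P
    unfolding r_def using that len inj set_index_pairs[of p q a] assms(4)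
    by (intro pairing_delta_eq_block_delta) (auto simp: right_index_eq)
  moreover have "(\<Prod>i=1..p. \<Prod>j=1..q. (u $ e i $ e j) ^ a i j) = (\<Prod>s\<in>{1..2*k}. u $ l s $ r s)"
    for u :: "real^'n^'n"
  proof -
    have "(\<Prod>i=1..p. \<Prod>j=1..q. (u $ e i $ e j) ^ a i j)
      = (\<Prod>s\<in>{1..2*k}. (\<lambda>(x, y). u $ e x $ e y) (?zs ! (s - 1)))"
      using prod_index_pairs[of "\<lambda>(x, y). u $ e x $ e y" p q a] len by simp
    also have "\<dots> = (\<Prod>s\<in>{1..2*k}. u $ l s $ r s)"
      using len by (intro prod.cong) (auto simp: l_def r_def left_index_eq right_index_eq case_prod_unfold)
    finally show ?thesis .
  qed
  ultimately show ?thesis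
    using weingarten_formula[OF assms(6), of l k r] by (simp add: n l_def r_def)
qed

end
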